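(* Let $p_{\xi}(n)$ be defined by $\sum_{n\ge 0} p_{\xi}(n)q^n=\xi(q)$. Then \begin{align*} \sum_{n=0}^{\infty} p_{\xi}(4n)q^n & = 4q^2\frac{f_{12}^6}{f_{3}^2f_{6}^3} - q^2 \omega(-q^3) + \frac{f_2^4f_6^5}{f_1^2f_3^4f_{12}^2},\\ \sum_{n=0}^{\infty} p_{\xi}(4n+1)q^n & = 2q\frac{f_{6}^3f_{12}^2}{f_{3}^4} + 2\frac{f_{4}^4f_{6}^5}{f_{2}^2f_{3}^4f_{12}^2},\\ \sum_{n=0}^{\infty} p_{\xi}(4n+2)q^n & = \frac{f_{6}^9}{f_{3}^6f_{12}^2} +\frac{f_{2}^{10}f_{12}^2}{f_{1}^4f_{3}^2f_{4}^4f_{6}},\\ 2\sum_{n=0}^{\infty} p_{\xi}(4n+3)q^{n+1} & = \frac{f_{6}^{15}}{f_3^8f_{12}^6} - f(q^6) + 4q\frac{f_{2}^4f_{12}^2}{f_{1}^2f_{3}^2f_{6}}. \end{align*}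
   Context: For $|q|<1$, $(a;q)_0=1$, $(a;q)_n=(1-a)(1-aq)\cdots(1-aq^{n-1})$, $(a;q)_\infty=\lim_{n\to\infty}(a;q)_n$, and $f_k:=(q^k;q^k)_\infty$. $\xi(q)=1+2\sum_{n\ge1}\frac{q^{6n^2-6n+1}}{(q;q^6)_n(q^5;q^6)_n}$ and $p_\xi(n)$ is its $n$-th coefficient. The third order mock theta functions $\omega$ and $f$ are $\omega(q)=\sum_{n\ge0}\frac{q^{2n(n+1)}}{(q;q^2)_{n+1}^2}$ and $f(q)=\sum_{n\ge0}\frac{q^{n^2}}{(-q;q)_n^2}$. *)

theory Defs
  imports "HOL-Complex_Analysis.Complex_Analysis"
begin

definition qpoch :: "complex \<Rightarrow> complex \<Rightarrow> nat \<Rightarrow> complex" where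
  "qpoch a q n = (\<Prod>k<n. 1 - a * q ^ k)"

definition qpoch_inf :: "complex \<Rightarrow> complex \<Rightarrow> complex" where
  "qpoch_inf a q = lim (\<lambda>n. qpoch a q n)"

text \<open>\<open>euler_f k q\<close> is the product written \<open>f\<^sub>k\<close>; it is unrelated to the mock theta
  function \<open>f\<close>, which is \<open>mock_f\<close> below.\<close>

definition euler_f :: "nat \<Rightarrow> complex \<Rightarrow> complex" where
  "euler_f k q = qpoch_inf (q ^ k) (q ^ k)"

definition mock_omega :: "complex \<Rightarrow> complex" where
  "mock_omega q = (\<Sum>n. q ^ (2 * n * (n + 1)) / (qpoch q (q ^ 2) (n + 1)) ^ 2)"

definition mock_f :: "complex \<Rightarrow> complex" where
  "mock_f q = (\<Sum>n. q ^ (n ^ 2) / (qpoch (- q) q n) ^ 2)"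

text \<open>The sum over \<open>n \<ge> 1\<close> is indexed by \<open>Suc n\<close>; there the subtraction of natural numbers
  in the exponent does not truncate.\<close>

definition xi_term :: "nat \<Rightarrow> complex \<Rightarrow> complex" where
  "xi_term n q = q ^ (6 * n ^ 2 - 6 * n + 1) / (qpoch q (q ^ 6) n * qpoch (q ^ 5) (q ^ 6) n)"

definition mock_xi :: "complex \<Rightarrow> complex" where
  "mock_xi q = 1 + 2 * (\<Sum>n. xi_term (Suc n) q)"

definition p_xi :: "nat \<Rightarrow> complex" where
  "p_xi n = fps_nth (fps_expansion mock_xi 0) n"

text \<open>The function \<open>mock_xi\<close> is holomorphic in the unit disc, so \<open>p_xi\<close> does satisfy
  its defining equation (lemma \<open>p_xi_sums\<close>).\<close>

lemma norm_qpoch_ge: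
  assumes "norm q \<le> r" "r < 1" "m > 0"
  shows "norm (qpoch (q ^ m) (q ^ 6) n) \<ge> (1 - r) ^ n"
proof -
  have r: "r \<ge> 0" using assms(1) norm_ge_zero order_trans by blast
  have "(\<Prod>k<n. 1 - r) \<le> (\<Prod>k<n. norm (1 - q ^ m * (q ^ 6) ^ k))"
  proof (rule prod_mono, safe)
    fix k
    show "0 \<le> 1 - r" using assms by simp
    have "norm (q ^ m * (q ^ 6) ^ k) = norm q ^ (m + 6 * k)"
      by (simp add: norm_mult norm_power power_add power_mult)
    also have "\<dots> \<le> r ^ (m + 6 * k)"
      by (rule power_mono) (use assms in auto)
    also have "\<dots> \<le> r ^ 1"
      by (rule power_decreasing) (use assms r in auto)
    finally have "norm (q ^ m * (q ^ 6) ^ k) \<le> r" by simp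
    thus "1 - r \<le> norm (1 - q ^ m * (q ^ 6) ^ k)"
      using norm_triangle_ineq2[of 1 "q ^ m * (q ^ 6) ^ k"] by simp
  qed
  thus ?thesis by (simp add: qpoch_def prod_norm)
qed

lemma qpoch_nonzero:
  assumes "norm q < 1" "m > 0"
  shows "qpoch (q ^ m) (q ^ 6) n \<noteq> 0"
proof -
  have "(1 - norm q) ^ n > 0" using assms by simp
  thus ?thesis using norm_qpoch_ge[OF order_refl assms, of n] by auto
qed

lemma norm_xi_term_le:
  assumes "norm q \<le> r" "r < 1"
  shows "norm (xi_term (Suc n) q) \<le> (r ^ (6 * n) / (1 - r) ^ 2) ^ Suc n"
proof -
  have r: "r \<ge> 0" using assms(1) norm_ge_zero order_trans by blast
  let ?D = "qpoch q (q ^ 6) (Suc n) * qpoch (q ^ 5) (q ^ 6) (Suc n)"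
  have D: "norm ?D \<ge> (1 - r) ^ Suc n * (1 - r) ^ Suc n"
    unfolding norm_mult
    using norm_qpoch_ge[OF assms, of 1 "Suc n"] norm_qpoch_ge[OF assms, of 5 "Suc n"] assms
    by (intro mult_mono) auto
  have e: "6 * Suc n ^ 2 - 6 * Suc n + 1 = 6 * n * Suc n + 1"
    by (simp add: power2_eq_square algebra_simps)
  have "norm q ^ (6 * n * Suc n + 1) \<le> r ^ (6 * n * Suc n + 1)"
    by (rule power_mono) (use assms in auto)
  also have "\<dots> \<le> r ^ (6 * n * Suc n)"
    by (rule power_decreasing) (use assms r in auto)
  finally have N: "norm q ^ (6 * n * Suc n + 1) \<le> r ^ (6 * n * Suc n)" .
  have "norm (xi_term (Suc n) q) = norm q ^ (6 * n * Suc n + 1) / norm ?D"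
    unfolding xi_term_def e by (simp only: norm_divide norm_power)
  also have "\<dots> \<le> r ^ (6 * n * Suc n) / ((1 - r) ^ Suc n * (1 - r) ^ Suc n)"
    by (rule frac_le) (use N D r assms in auto)
  also have "\<dots> = (r ^ (6 * n) / (1 - r) ^ 2) ^ Suc n"
    by (simp only: power_divide power_mult[symmetric] power_add[symmetric])
       (simp add: mult_2)
  finally show ?thesis .
qed

lemma mock_xi_holomorphic: "mock_xi holomorphic_on ball 0 1"
proof -
  have "(\<lambda>q. \<Sum>n. xi_term (Suc n) q) holomorphic_on ball 0 1"
  proof (rule holomorphic_uniform_sequence[where f = "\<lambda>N q. \<Sum>n<N. xi_term (Suc n) q"])
    show "open (ball (0::complex) 1)" by simp
  next
    fix N
    have "qpoch q (q ^ 6) n \<noteq> 0" if "norm q < 1" for q n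
      using qpoch_nonzero[OF that, of 1] by simp
    moreover have "qpoch (q ^ 5) (q ^ 6) n \<noteq> 0" if "norm q < 1" for q n
      using qpoch_nonzero[OF that, of 5] by simp
    moreover have "(\<lambda>q. qpoch q (q ^ 6) n) holomorphic_on ball 0 1"
      "(\<lambda>q. qpoch (q ^ 5) (q ^ 6) n) holomorphic_on ball 0 1" for n
      unfolding qpoch_def by (intro holomorphic_intros)+
    ultimately show "(\<lambda>q. \<Sum>n<N. xi_term (Suc n) q) holomorphic_on ball 0 1"
      unfolding xi_term_def by (intro holomorphic_intros) auto
  next
    fix x :: complex assume x: "x \<in> ball 0 1"
    define r where "r = (1 + norm x) / 2"
    have r: "norm x < r" "r < 1" "r > 0"
      using x norm_ge_zero[of x] by (auto simp: r_def simp del: norm_ge_zero)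
    have sub: "cball x (r - norm x) \<subseteq> cball 0 r"
      by (auto simp: dist_norm) (smt (verit) norm_minus_commute norm_triangle_ineq2)
    have "(\<lambda>n. (r ^ 6) ^ n / (1 - r) ^ 2) \<longlonglongrightarrow> 0 / (1 - r) ^ 2"
      by (intro tendsto_intros LIMSEQ_power_zero)
         (use r in \<open>auto simp: power_less_one_iff\<close>)
    hence "eventually (\<lambda>n. (r ^ 6) ^ n / (1 - r) ^ 2 < 1 / 2) sequentially"
      by (rule order_tendstoD) auto
    hence ev: "eventually (\<lambda>n. norm ((r ^ (6 * n) / (1 - r) ^ 2) ^ Suc n) \<le> (1 / 2) ^ Suc n) sequentially"
    proof eventually_elim
      case (elim n)
      thus ?case using r by (auto simp: power_mult norm_power intro!: power_mono simp del: power_Suc)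
    qed
    have "summable (\<lambda>n. (1 / 2 :: real) ^ Suc n)"
      by (subst summable_Suc_iff) (auto intro: summable_geometric)
    hence "summable (\<lambda>n. (r ^ (6 * n) / (1 - r) ^ 2) ^ Suc n)"
      by (rule summable_comparison_test_ev[OF ev])
    hence "uniform_limit (cball 0 r) (\<lambda>N q. \<Sum>n<N. xi_term (Suc n) q)
             (\<lambda>q. \<Sum>n. xi_term (Suc n) q) sequentially"
      by (intro Weierstrass_m_test[OF norm_xi_term_le]) (use r in auto)
    hence "uniform_limit (cball x (r - norm x)) (\<lambda>N q. \<Sum>n<N. xi_term (Suc n) q)
             (\<lambda>q. \<Sum>n. xi_term (Suc n) q) sequentially"
      using sub by (rule uniform_limit_on_subset)
    moreover have "cball x (r - norm x) \<subseteq> ball 0 1"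
      using sub r by (force simp: subset_iff)
    ultimately show "\<exists>d>0. cball x d \<subseteq> ball 0 1 \<and>
        uniform_limit (cball x d) (\<lambda>N q. \<Sum>n<N. xi_term (Suc n) q)
          (\<lambda>q. \<Sum>n. xi_term (Suc n) q) sequentially"
      using r by (intro exI[of _ "r - norm x"]) auto
  qed
  thus ?thesis unfolding mock_xi_def by (intro holomorphic_intros)
qed

lemma p_xi_sums:
  assumes "norm q < 1"
  shows "(\<lambda>n. p_xi n * q ^ n) sums mock_xi q"
  using holomorphic_power_series[OF mock_xi_holomorphic, of q] assms
  by (simp add: p_xi_def fps_expansion_def)

end

theory Submission
  imports Defs
begin

text \<open>
  Write \<open>\<theta>(x; q) = (x; q)\<^sub>\<infinity> (q/x; q)\<^sub>\<infinity>\<close>.  Lagrange interpolation of a finite version of \<open>1/\<theta>\<close> and a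
  passage to the limit give
  \<open>(q; q)\<^sub>\<infinity>\<^sup>2 / \<theta>(x; q) = \<Sum>\<^sub>r (-1)\<^sup>r q\<^bsup>r(r+1)/2\<^esup> / (1 - x q\<^sup>r)\<close>, summed over all integers.  The finite
  version is also a Bailey pair, and together with
  \<open>\<Sum>\<^sub>m q\<^bsup>m(m+k)\<^esup> / ((q; q)\<^sub>m (q; q)\<^bsub>m+k\<^esub>) = 1/(q; q)\<^sub>\<infinity>\<close> it turns \<open>\<xi>\<close>, \<open>\<omega>\<close> and \<open>f\<close> into
  Appell-Lerch sums.  Two identities follow.  Splitting the expansion of \<open>1/\<theta>(q; q\<^sup>2)\<close> modulo 3 gives
  \<open>\<xi>(q) = q\<^sup>2 \<omega>(q\<^sup>3) + f\<^sub>2\<^sup>4 / (f\<^sub>1\<^sup>2 f\<^sub>6)\<close>.  Multiplying the expansions of \<open>1/\<theta>(q; q\<^sup>2)\<close> and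
  \<open>1/\<theta>(-1; q\<^sup>4)\<close> and separating the poles gives Watson's relation
  \<open>f(q\<^sup>8) + 2q \<omega>(q) + 2q\<^sup>3 \<omega>(-q\<^sup>4) = f\<^sub>2 f\<^sub>4\<^sup>6 / (f\<^sub>1\<^sup>2 f\<^sub>8\<^sup>4)\<close>.  Eliminating \<open>\<omega>(q\<^sup>3)\<close> leaves
  \<open>2q \<xi>(q)\<close> as theta quotients plus \<open>f(q\<^bsup>24\<^esup>)\<close> and \<open>q\<^sup>9 \<omega>(-q\<^bsup>12\<^esup>)\<close>, which already lie in fixed residue
  classes modulo 4; the theta quotients are dissected by classical identities for
  \<open>\<phi>(q) = \<Sum> q\<^bsup>n*n\<^esup>\<close> and \<open>\<psi>(q) = \<Sum> q\<^bsup>n(n+1)/2\<^esup>\<close>.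
\<close>

section \<open>Infinite q-products and theta functions\<close>

lemma qpoch_0 [simp]: "qpoch a q 0 = 1"
  by (simp add: qpoch_def)

lemma qpoch_Suc: "qpoch a q (Suc n) = qpoch a q n * (1 - a * q ^ n)"
  by (simp add: qpoch_def)

lemma qpoch_Suc_left: "qpoch a q (Suc n) = (1 - a) * qpoch (a * q) q n"
  unfolding qpoch_def by (subst prod.lessThan_Suc_shift) (simp add: mult_ac)

lemma qpoch_eq_0_iff: "qpoch a q n = 0 \<longleftrightarrow> (\<exists>k<n. a * q ^ k = 1)"
  by (auto simp: qpoch_def)

lemma abs_convergent_prod_qpoch:
  fixes a q :: complex
  assumes "norm q < 1"
  shows "abs_convergent_prod (\<lambda>k. 1 - a * q ^ k)"
proof -
  have "summable (\<lambda>k. norm (1 - a * q ^ k - 1))"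
    using summable_mult[OF summable_geometric[of "norm q"], of "norm a"] assms
    by (simp add: norm_mult norm_power)
  thus ?thesis
    by (simp only: abs_convergent_prod_conv_summable)
qed

text \<open>\<open>qpoch_inf\<close> is defined through \<open>lim\<close>, which carries
  information only once convergence is known. Identities of infinite products are then limits of
  finite ones.\<close>

lemma qpoch_LIMSEQ:
  assumes "norm q < 1"
  shows "qpoch a q \<longlonglongrightarrow> qpoch_inf a q"
proof -
  have "(\<lambda>n. \<Prod>k\<le>n. 1 - a * q ^ k) \<longlonglongrightarrow> prodinf (\<lambda>k. 1 - a * q ^ k)"
    by (intro convergent_prod_LIMSEQ abs_convergent_prod_imp_convergent_prod
        abs_convergent_prod_qpoch assms)
  hence "(\<lambda>n. \<Prod>k<n. 1 - a * q ^ k) \<longlonglongrightarrow> prodinf (\<lambda>k. 1 - a * q ^ k)"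
    by (simp add: LIMSEQ_lessThan_iff_atMost)
  hence "qpoch a q \<longlonglongrightarrow> prodinf (\<lambda>k. 1 - a * q ^ k)"
    by (simp add: qpoch_def[abs_def])
  thus ?thesis
    by (simp add: qpoch_inf_def limI)
qed

lemma qpoch_inf_unique:
  assumes "qpoch a q \<longlonglongrightarrow> L"
  shows "qpoch_inf a q = L"
  using assms by (simp add: qpoch_inf_def limI)

lemma qpoch_inf_nonzero:
  assumes "norm q < 1" "\<And>k. a * q ^ k \<noteq> 1"
  shows "qpoch_inf a q \<noteq> 0"
proof -
  have c: "convergent_prod (\<lambda>k. 1 - a * q ^ k)"
    by (intro abs_convergent_prod_imp_convergent_prod abs_convergent_prod_qpoch assms)
  have "qpoch_inf a q = prodinf (\<lambda>k. 1 - a * q ^ k)"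
    by (subst prodinf_eq_lim'[OF c]) (use assms in \<open>simp_all add: qpoch_inf_def qpoch_def\<close>)
  thus ?thesis
    using prodinf_nonzero[OF c] assms by simp
qed

lemma qpoch_inf_nonzero':
  assumes "norm q < 1" "norm a < 1"
  shows "qpoch_inf a q \<noteq> 0"
proof (rule qpoch_inf_nonzero)
  fix k
  have "norm q ^ k \<le> 1"
    using assms by (intro power_le_one) auto
  hence "norm (a * q ^ k) < 1"
    using assms(2) mult_left_le[of "norm q ^ k" "norm a"] by (simp add: norm_mult norm_power)
  thus "a * q ^ k \<noteq> 1" by auto
qed fact

lemma qpoch_inf_rec:
  assumes "norm q < 1"
  shows "qpoch_inf a q = (1 - a) * qpoch_inf (a * q) q"
proof -
  have "(\<lambda>n. qpoch a q (Suc n)) \<longlonglongrightarrow> (1 - a) * qpoch_inf (a * q) q"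
    unfolding qpoch_Suc_left by (intro tendsto_intros qpoch_LIMSEQ assms)
  thus ?thesis
    by (intro qpoch_inf_unique) (simp add: filterlim_sequentially_Suc)
qed

text \<open>The exponents of \<open>q\<close> are sorted by their residue modulo \<open>m\<close>;
  each class is again a finite product, with base \<open>q ^ m\<close>.\<close>

lemma qpoch_mult_split: "qpoch a q (m * n) = (\<Prod>j<m. qpoch (a * q ^ j) (q ^ m) n)"
proof -
  have "(\<Prod>k<m * n. 1 - a * q ^ k) = (\<Prod>k<n. \<Prod>j<m. 1 - a * q ^ (j + k * m))"
    by (subst mult.commute, subst prod.nat_group[symmetric])
       (simp add: prod.shift_bounds_nat_ivl[of _ 0, simplified] atLeast0LessThan add.commute)
  also have "\<dots> = (\<Prod>j<m. \<Prod>k<n. 1 - a * q ^ j * (q ^ m) ^ k)"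
    by (subst prod.swap) (simp add: power_add power_mult[symmetric] mult_ac)
  finally show ?thesis by (simp add: qpoch_def)
qed

lemma qpoch_inf_split:
  assumes "norm q < 1" "m > 0"
  shows "qpoch_inf a q = (\<Prod>j<m. qpoch_inf (a * q ^ j) (q ^ m))"
proof -
  have qm: "norm (q ^ m) < 1"
    using assms by (simp add: norm_power power_less_one_iff)
  have "(\<lambda>n. qpoch a q (m * n)) \<longlonglongrightarrow> (\<Prod>j<m. qpoch_inf (a * q ^ j) (q ^ m))"
    unfolding qpoch_mult_split by (intro tendsto_prod qpoch_LIMSEQ qm)
  moreover have "(\<lambda>n. qpoch a q (m * n)) \<longlonglongrightarrow> qpoch_inf a q"
    by (rule filterlim_compose[OF qpoch_LIMSEQ[OF assms(1)]])
       (use assms(2) in \<open>intro mult_nat_left_at_top\<close>)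
  ultimately show ?thesis
    using LIMSEQ_unique by blast
qed

lemma qpoch_inf_mult_neg:
  assumes "norm q < 1"
  shows "qpoch_inf a q * qpoch_inf (- a) q = qpoch_inf (a ^ 2) (q ^ 2)"
proof -
  have "qpoch a q n * qpoch (- a) q n = qpoch (a ^ 2) (q ^ 2) n" for n
    unfolding qpoch_def prod.distrib[symmetric]
    by (intro prod.cong) (auto simp: algebra_simps power2_eq_square power_mult_distrib)
  hence "qpoch (a ^ 2) (q ^ 2) \<longlonglongrightarrow> qpoch_inf a q * qpoch_inf (- a) q"
    using tendsto_mult[OF qpoch_LIMSEQ[OF assms, of a] qpoch_LIMSEQ[OF assms, of "- a"]] by simp
  thus ?thesis
    by (simp add: qpoch_inf_unique)
qed

lemma euler_f_nonzero:
  assumes "norm q < 1" "k > 0"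
  shows "euler_f k q \<noteq> 0"
  using assms unfolding euler_f_def
  by (intro qpoch_inf_nonzero') (auto simp: norm_power power_less_one_iff)

lemma euler_f_power: "euler_f k (q ^ m) = euler_f (m * k) q"
  by (simp add: euler_f_def power_mult)

section \<open>Theta products and their quasi-periodicity\<close>

definition theta :: "complex \<Rightarrow> complex \<Rightarrow> complex" where
  "theta x q = qpoch_inf x q * qpoch_inf (q / x) q"

text \<open>Passing from \<open>x\<close> to \<open>q * x\<close> removes the factor
  \<open>1 - x\<close> from the first product and adds \<open>1 - 1 / x\<close> to the second; their
  ratio is \<open>- 1 / x\<close>.\<close>

lemma theta_shift:
  assumes "norm q < 1" "q \<noteq> 0" "x \<noteq> 0"
  shows "theta (q * x) q = - theta x q / x"
proof -
  have 1: "qpoch_inf x q = (1 - x) * qpoch_inf (q * x) q"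
    using qpoch_inf_rec[OF assms(1), of x] by (simp add: mult.commute)
  have 2: "qpoch_inf (1 / x) q = (1 - 1 / x) * qpoch_inf (q / x) q"
    using qpoch_inf_rec[OF assms(1), of "1 / x"] by simp
  show ?thesis
    using assms unfolding theta_def 1 by (simp add: 2 field_simps)
qed

text \<open>Iterates \<open>theta_shift\<close> in both directions, so that arguments differing by
  powers of \<open>q\<close> can be brought back to a fixed one. The accumulated exponent of
  \<open>q\<close> is half of \<open>j * (j - 1)\<close>, hence the square root
  \<open>t\<close>.\<close>

lemma theta_shift_int:
  assumes "norm q < 1" "q = t ^ 2" "t \<noteq> 0" "x \<noteq> 0"
  shows "theta (q powi j * x) q * ((- x) powi j * t powi (j * (j - 1))) = theta x q"
proof (induction j rule: int_induct[where k = 0])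
  case (step1 i)
  have e: "t powi ((i + 1) * (i + 1 - 1)) = t powi (i * (i - 1)) * t powi (2 * i)"
    using assms by (simp add: power_int_add[symmetric] algebra_simps)
  have q: "q powi i = t powi (2 * i)"
    unfolding assms(2) by (simp add: power_int_power)
  have "theta (q powi (i + 1) * x) q = theta (q * (q powi i * x)) q"
    using assms by (simp add: power_int_add mult_ac)
  also have "\<dots> = - theta (q powi i * x) q / (q powi i * x)"
    using assms by (intro theta_shift) auto
  finally have th: "theta (q powi (i + 1) * x) q = - theta (q powi i * x) q / (q powi i * x)" .
  have m: "(- x) powi (i + 1) = (- x) powi i * (- x)"
    using assms by (simp add: power_int_add)
  have "theta (q powi (i + 1) * x) q * ((- x) powi (i + 1) * t powi ((i + 1) * (i + 1 - 1)))
      = theta (q powi i * x) q * ((- x) powi i * t powi (i * (i - 1)))"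
    unfolding th m e q using assms(3,4) by (simp add: field_simps)
  thus ?case using step1.IH by simp
next
  case (step2 i)
  have e: "t powi (i * (i - 1)) = t powi ((i - 1) * (i - 1 - 1)) * t powi (2 * (i - 1))"
    using assms by (simp add: power_int_add[symmetric] algebra_simps)
  have q: "q powi (i - 1) = t powi (2 * (i - 1))"
    unfolding assms(2) by (simp add: power_int_power)
  have "theta (q powi i * x) q = theta (q * (q powi (i - 1) * x)) q"
    using assms by (simp add: power_int_diff)
  also have "\<dots> = - theta (q powi (i - 1) * x) q / (q powi (i - 1) * x)"
    using assms by (intro theta_shift) auto
  finally have th: "theta (q powi i * x) q = - theta (q powi (i - 1) * x) q / (q powi (i - 1) * x)" .
  have m: "(- x) powi i = (- x) powi (i - 1) * (- x)"
    using assms by (simp add: power_int_diff)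
  have "theta (q powi i * x) q * ((- x) powi i * t powi (i * (i - 1)))
      = theta (q powi (i - 1) * x) q * ((- x) powi (i - 1) * t powi ((i - 1) * (i - 1 - 1)))"
    unfolding th m e q using assms(3,4) by (simp add: field_simps)
  thus ?case using step2.IH by simp
qed simp

text \<open>\<open>rqp q k\<close> is \<open>1/(q; q)\<^sub>k\<close>, extended by zero to \<open>k < 0\<close>: all finite sums below become sums over
  the integers, which can be shifted freely.\<close>

definition rqp :: "complex \<Rightarrow> int \<Rightarrow> complex" where
  "rqp q k = (if k < 0 then 0 else 1 / qpoch q q (nat k))"

lemma power_Suc_neq_1:
  fixes q :: complex
  assumes "norm q < 1"
  shows "q * q ^ k \<noteq> 1"
proof
  assume "q * q ^ k = 1"
  hence "norm (q ^ Suc k) = 1" by simp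
  moreover have "norm (q ^ Suc k) < 1"
    using assms unfolding norm_power by (subst power_less_one_iff) auto
  ultimately show False by simp
qed

text \<open>The norm is compared rather than the value, so that \<open>q powi k = - 1\<close> and
  other values on the unit circle are excluded as well.\<close>

lemma powi_neq_1:
  fixes q :: complex
  assumes "norm q < 1" "q \<noteq> 0" "k \<noteq> 0"
  shows "norm (q powi k) \<noteq> 1"
proof (cases "k > 0")
  case True
  thus ?thesis using assms
    by (metis norm_ge_zero norm_power_int power_int_nonneg_exp less_le_not_le zero_less_nat_eq
        power_less_one_iff order_less_irrefl)
next
  case False
  have "norm (q powi (- k)) < 1"
    using assms False
    by (metis norm_ge_zero norm_power_int power_int_nonneg_exp zero_less_nat_eq
        power_less_one_iff neg_0_less_iff_less linorder_neqE order_less_imp_le)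
  thus ?thesis
    using assms(2) by (auto simp: power_int_minus norm_inverse norm_power_int)
qed

text \<open>The extension by zero respects the recurrence: at \<open>k = 0\<close> the factor
  \<open>1 - q powi 0\<close> vanishes, just as \<open>rqp q (- 1)\<close> does, and for
  \<open>k < 0\<close> both sides are zero.\<close>

lemma rqp_rec:
  assumes "norm q < 1" "q \<noteq> 0"
  shows "(1 - q powi k) * rqp q k = rqp q (k - 1)"
proof (cases "k \<le> 0")
  case True
  thus ?thesis by (cases "k = 0") (auto simp: rqp_def)
next
  case False
  then obtain n where n: "k = int (Suc n)"
    by (metis gr0_implies_Suc not_le zero_less_imp_eq_int)
  have [simp]: "k - 1 = int n" "nat k = Suc n" "nat (1 + int n) = Suc n" using n by simp_all
  have "q powi k = q * q ^ n" using n by (metis power_Suc power_int_of_nat)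
  moreover have "1 - q * q ^ n \<noteq> 0" "qpoch q q n \<noteq> 0"
    using power_Suc_neq_1[OF assms(1)] by (auto simp: qpoch_eq_0_iff)
  ultimately show ?thesis
    using n False by (simp add: rqp_def qpoch_Suc field_simps)
qed

lemma rqp_LIMSEQ:
  assumes "norm q < 1"
  shows "(\<lambda>n. rqp q (int n + k)) \<longlonglongrightarrow> 1 / qpoch_inf q q"
proof -
  have "(\<lambda>n. 1 / qpoch q q n) \<longlonglongrightarrow> 1 / qpoch_inf q q"
    by (intro tendsto_intros qpoch_LIMSEQ assms qpoch_inf_nonzero power_Suc_neq_1)
  moreover have "filterlim (\<lambda>n. nat (int n + k)) at_top sequentially"
    unfolding filterlim_at_top
  proof
    fix Z
    show "\<forall>\<^sub>F n in sequentially. Z \<le> nat (int n + k)"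
      using eventually_ge_at_top[of "Z + nat \<bar>k\<bar>"] by eventually_elim linarith
  qed
  ultimately have "(\<lambda>n. 1 / qpoch q q (nat (int n + k))) \<longlonglongrightarrow> 1 / qpoch_inf q q"
    by (rule filterlim_compose)
  moreover have "\<forall>\<^sub>F n in sequentially. 1 / qpoch q q (nat (int n + k)) = rqp q (int n + k)"
    using eventually_ge_at_top[of "nat \<bar>k\<bar>"] by eventually_elim (auto simp: rqp_def)
  ultimately show ?thesis
    using tendsto_cong by fast
qed

text \<open>A convergent sequence is bounded; the constant \<open>K\<close> enters the majorants of
  all limit passages below.\<close>

lemma rqp_bounded:
  assumes "norm q < 1"
  obtains K where "K > 0" "\<And>k. norm (rqp q k) \<le> K"
proof -
  have "Bseq (\<lambda>n. rqp q (int n + 0))"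
    using rqp_LIMSEQ[OF assms, of 0] by (intro convergent_imp_Bseq) (auto simp: convergent_def)
  then obtain K where K: "K > 0" "\<And>n. norm (rqp q (int n)) \<le> K"
    by (auto simp: Bseq_def)
  have "norm (rqp q k) \<le> K" for k
    using K(1) K(2)[of "nat k"] by (cases "k < 0") (auto simp: rqp_def)
  thus ?thesis using that K(1) by blast
qed

section \<open>Sums over the integers\<close>

text \<open>Tannery's theorem. By the Weierstrass test the finite partial sums converge uniformly in
  \<open>n\<close>, so the limit in \<open>n\<close> and the limit over finite sets may be
  exchanged.\<close>

lemma has_sum_dominated:
  fixes f :: "nat \<Rightarrow> 'a \<Rightarrow> 'b :: banach"
  assumes f: "\<And>n. (f n has_sum F n) A"
    and bound: "\<And>n x. x \<in> A \<Longrightarrow> norm (f n x) \<le> g x"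
    and g: "g summable_on A"
    and lim: "\<And>x. x \<in> A \<Longrightarrow> (\<lambda>n. f n x) \<longlonglongrightarrow> h x"
    and F: "F \<longlonglongrightarrow> L"
  shows "(h has_sum L) A"
proof -
  have "norm (h x) \<le> g x" if "x \<in> A" for x
    by (rule Lim_norm_ubound[OF _ lim[OF that]]) (use bound[OF that] in auto)
  hence h: "h summable_on A"
    using Infinite_Sum.abs_summable_on_comparison_test'[OF g] by (blast intro: abs_summable_summable)
  have "F \<longlonglongrightarrow> infsum h A"
  proof (rule swap_uniform_limit')
    show "(sum h \<longlongrightarrow> infsum h A) (finite_subsets_at_top A)"
      using has_sum_infsum[OF h] by (simp add: has_sum_def)
    show "\<forall>\<^sub>F X in finite_subsets_at_top A. (\<lambda>n. \<Sum>x\<in>X. f n x) \<longlonglongrightarrow> sum h X"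
      by (intro eventually_finite_subsets_at_top_weakI tendsto_sum lim) auto
    show "uniform_limit UNIV (\<lambda>X n. \<Sum>x\<in>X. f n x) F (finite_subsets_at_top A)"
      using Weierstrass_m_test_general[of A UNIV "\<lambda>x n. f n x" g, OF _ g] bound infsumI[OF f]
      by simp
  qed auto
  hence "L = infsum h A"
    using F LIMSEQ_unique by blast
  thus ?thesis using h by simp
qed

lemma has_sum_int_shift:
  fixes f :: "int \<Rightarrow> 'a :: {comm_monoid_add, topological_space}"
  shows "((\<lambda>r. f (r + k)) has_sum S) UNIV \<longleftrightarrow> (f has_sum S) UNIV"
  by (rule has_sum_reindex_bij_betw) (rule bij_betwI[of _ _ _ "\<lambda>r. r - k"], auto)

lemma has_sum_int_reflect:
  fixes f :: "int \<Rightarrow> 'a :: {comm_monoid_add, topological_space}"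
  shows "((\<lambda>r. f (k - r)) has_sum S) UNIV \<longleftrightarrow> (f has_sum S) UNIV"
  by (rule has_sum_reindex_bij_betw) (rule bij_betwI[of _ _ _ "\<lambda>r. k - r"], auto)

lemma summable_on_quadratic_nat:
  fixes a b :: real
  assumes "0 < a" "a < 1" "0 < b"
  shows "(\<lambda>n::nat. a ^ (n * n) * b ^ n) summable_on UNIV"
proof -
  have "(\<lambda>n. a ^ n * b) \<longlonglongrightarrow> 0 * b"
    by (intro tendsto_intros LIMSEQ_power_zero) (use assms in auto)
  hence "\<forall>\<^sub>F n in sequentially. a ^ n * b < 1 / 2"
    by (rule order_tendstoD) auto
  hence "\<forall>\<^sub>F n in sequentially. norm (a ^ (n * n) * b ^ n) \<le> (1 / 2) ^ n"
  proof eventually_elim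
    case (elim n)
    have "a ^ (n * n) * b ^ n = (a ^ n * b) ^ n"
      by (simp add: power_mult power_mult_distrib)
    thus ?case using elim assms by (auto intro!: power_mono)
  qed
  hence "summable (\<lambda>n. a ^ (n * n) * b ^ n)"
    by (rule summable_comparison_test_ev) (simp add: summable_geometric)
  thus ?thesis
    using assms by (subst summable_on_UNIV_nonneg_real_iff) auto
qed

text \<open>A quadratic exponent over a base below 1 beats any linear one. The negative half-line is
  the one-sided case with \<open>inverse b\<close>.\<close>

lemma summable_on_quadratic:
  fixes a b :: real
  assumes "0 < a" "a < 1" "0 < b"
  shows "(\<lambda>r::int. a powi (r * r) * b powi r) summable_on UNIV"
proof -
  let ?f = "\<lambda>r::int. a powi (r * r) * b powi r"
  have 1: "?f summable_on {0..}"
  proof -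
    have "(\<lambda>n. ?f (int n)) summable_on UNIV"
      using summable_on_quadratic_nat[OF assms] by (simp flip: of_nat_mult)
    moreover have "bij_betw int UNIV {0..}"
      by (rule bij_betwI[of _ _ _ nat]) auto
    ultimately show ?thesis
      using summable_on_reindex_bij_betw by blast
  qed
  have 2: "?f summable_on {..0}"
  proof -
    have "(\<lambda>n. ?f (- int n)) summable_on UNIV"
      using summable_on_quadratic_nat[of a "inverse b"] assms
      by (simp add: power_int_minus power_inverse flip: of_nat_mult)
    moreover have "bij_betw (\<lambda>n. - int n) UNIV {..0}"
      by (rule bij_betwI[of _ _ _ "\<lambda>r. nat (- r)"]) auto
    ultimately show ?thesis
      using summable_on_reindex_bij_betw[of "\<lambda>n. - int n" UNIV "{..0}" ?f] by blast
  qed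
  have "?f summable_on ({0..} \<union> {..0})"
    by (rule summable_on_union[OF 1 2])
  moreover have "{0..} \<union> {..0} = (UNIV :: int set)" by auto
  ultimately show ?thesis by metis
qed

text \<open>\<open>x * q powi r\<close> tends to 0 as \<open>r\<close> grows and is unbounded as
  \<open>r\<close> decreases, so only finitely many values come near 1, and their least distance to
  1 is positive.\<close>

lemma powi_pole_distance:
  fixes q x :: complex
  assumes q: "norm q < 1" "q \<noteq> 0" and x: "x \<noteq> 0" "\<And>r. x * q powi r \<noteq> 1"
  obtains d where "d > 0" "\<And>r. d \<le> norm (1 - x * q powi r)"
proof -
  have "(\<lambda>n. norm q ^ n) \<longlonglongrightarrow> 0"
    using q by (intro LIMSEQ_power_zero) auto
  hence "\<forall>\<^sub>F n in sequentially. norm q ^ n < min (1 / (2 * norm x)) (norm x / 2)"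
    by (rule order_tendstoD) (use x in auto)
  \<comment> \<open>For \<open>r > int R\<close> the first bound gives a norm below 1/2, for
    \<open>r < - int R\<close> the second gives a norm of at least 2; the distance to 1 is at least
    1/2 in both cases.\<close>
  then obtain R where R: "\<And>n. n \<ge> R \<Longrightarrow> norm q ^ n < min (1 / (2 * norm x)) (norm x / 2)"
    by (auto simp: eventually_sequentially)
  define D where "D = Min ((\<lambda>r. norm (1 - x * q powi r)) ` {- int R..int R})"
  have D: "D \<le> norm (1 - x * q powi r)" if "r \<in> {- int R..int R}" for r
    unfolding D_def by (intro Min_le) (use that in auto)
  have "D \<in> (\<lambda>r. norm (1 - x * q powi r)) ` {- int R..int R}"
    unfolding D_def by (intro Min_in) auto
  hence Dpos: "D > 0" using x(2) by auto
  show ?thesis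
  proof (rule that[of "min D (1 / 2)"])
    fix r
    consider "r > int R" | "r < - int R" | "r \<in> {- int R..int R}" by force
    thus "min D (1 / 2) \<le> norm (1 - x * q powi r)"
    proof cases
      case 1
      hence "q powi r = q ^ nat r" by (simp add: power_int_nonneg_exp)
      hence e: "norm (x * q powi r) = norm x * norm q ^ nat r"
        by (simp only: norm_mult norm_power)
      have "R \<le> nat r" using 1 by linarith
      hence "norm q ^ nat r < 1 / (2 * norm x)" using R by simp
      hence "norm q ^ nat r * (2 * norm x) < 1"
        by (subst (asm) pos_less_divide_eq) (use x in auto)
      hence "norm (x * q powi r) < 1 / 2" unfolding e by (simp add: mult_ac)
      thus ?thesis using norm_triangle_ineq2[of 1 "x * q powi r"] unfolding norm_one by linarith
    next
      case 2
      hence "q powi r = inverse (q ^ nat (- r))"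
        by (simp add: power_int_def power_inverse)
      hence e: "norm (x * q powi r) = norm x / norm q ^ nat (- r)"
        by (simp only: norm_mult norm_inverse norm_power divide_inverse)
      have "R \<le> nat (- r)" using 2 by linarith
      hence "norm q ^ nat (- r) < norm x / 2" using R by simp
      hence "2 * norm q ^ nat (- r) \<le> norm x" by linarith
      moreover have "norm q ^ nat (- r) > 0" using q by simp
      ultimately have "2 \<le> norm (x * q powi r)"
        unfolding e by (subst pos_le_divide_eq)
      thus ?thesis using norm_triangle_ineq2[of "x * q powi r" 1] norm_minus_commute[of 1 "x * q powi r"]
        unfolding norm_one by linarith
    next
      case 3
      thus ?thesis using D[of r] by linarith
    qed
  qed (use Dpos in auto)
qed

lemma summable_on_times_norm:
  fixes f :: "'a \<Rightarrow> real" and g :: "'b \<Rightarrow> real"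
  assumes "f summable_on A" "g summable_on B" "\<And>x. f x \<ge> 0" "\<And>y. g y \<ge> 0"
  shows "(\<lambda>(x, y). f x * g y) summable_on A \<times> B"
proof (rule summable_on_SigmaI[where g = "\<lambda>x. f x * infsum g B"])
  show "((\<lambda>y. case (x, y) of (x, y) \<Rightarrow> f x * g y) has_sum f x * infsum g B) B" for x
    using has_sum_cmult_right[OF has_sum_infsum[OF assms(2)], of "f x"] by simp
  show "(\<lambda>x. f x * infsum g B) summable_on A"
    by (rule summable_on_cmult_left[OF assms(1)])
qed (use assms(3,4) in auto)

text \<open>Absolute summability gives rows and columns the same total; this common \<open>S\<close>
  is how two expansions of a double sum get compared.\<close>

lemma has_sum_fubini:
  fixes G :: "'a \<Rightarrow> 'b \<Rightarrow> 'c :: banach"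
  assumes "(\<lambda>(x, y). norm (G x y)) summable_on A \<times> B"
    and "\<And>x. x \<in> A \<Longrightarrow> (G x has_sum R x) B"
    and "\<And>y. y \<in> B \<Longrightarrow> ((\<lambda>x. G x y) has_sum C y) A"
  obtains S where "(R has_sum S) A" "(C has_sum S) B"
proof -
  have "(\<lambda>(x, y). G x y) summable_on A \<times> B"
    by (rule abs_summable_summable) (use assms(1) in \<open>simp add: case_prod_unfold\<close>)
  then obtain S where S: "((\<lambda>(x, y). G x y) has_sum S) (A \<times> B)"
    by (auto simp: summable_on_def)
  have "(R has_sum S) A"
    by (rule has_sum_SigmaD[OF S]) (use assms(2) in auto)
  moreover have "((\<lambda>(x, y). G y x) has_sum S) (B \<times> A)"
    using S has_sum_swap[of "\<lambda>(x, y). G x y" A B S] by (simp add: case_prod_unfold)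
  hence "(C has_sum S) B"
    by (rule has_sum_SigmaD) (use assms(3) in auto)
  ultimately show ?thesis using that by blast
qed

section \<open>The triple product and the partial fractions of 1/theta\<close>

definition tcoef :: "complex \<Rightarrow> int \<Rightarrow> complex" where
  "tcoef t r = (- 1) powi r * t powi (r * (r + 1))"

text \<open>The base is a square, \<open>q = t\<^sup>2\<close>, so that \<open>q\<^bsup>r(r+1)/2\<^esup>\<close> is the integer power \<open>t\<^bsup>r(r+1)\<^esup>\<close>.\<close>

locale nome =
  fixes t q :: complex
  assumes norm_t: "norm t < 1" and t_nz: "t \<noteq> 0" and q_eq: "q = t ^ 2"
begin

lemma norm_q: "norm q < 1"
  unfolding q_eq norm_power using norm_t by (subst power_less_one_iff) auto

lemma q_nz: "q \<noteq> 0"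
  using t_nz by (simp add: q_eq)

lemma q_powi: "q powi r = t powi (2 * r)"
  by (simp add: q_eq power_int_power)

lemma tcoef_rec: "tcoef t r = - (q powi r) * tcoef t (r - 1)"
proof -
  have "t powi (r * (r + 1)) = q powi r * t powi ((r - 1) * (r - 1 + 1))"
    unfolding q_powi using t_nz by (subst power_int_add[symmetric]) (auto simp: algebra_simps)
  moreover have "(- 1 :: complex) powi r = - ((- 1) powi (r - 1))"
    by (simp add: power_int_diff)
  ultimately show ?thesis by (simp add: tcoef_def)
qed

lemma one_minus_q_powi_nz: "k \<noteq> 0 \<Longrightarrow> 1 - q powi k \<noteq> 0"
  using powi_neq_1[OF norm_q q_nz, of k] by auto

text \<open>Up to the factor \<open>qpoch q q (M + N)\<close> the two \<open>rqp\<close> factors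
  form a Gaussian binomial coefficient; they vanish outside \<open>- int M \<le> r\<close> and
  \<open>r \<le> int N\<close>.\<close>

definition jtp_term :: "complex \<Rightarrow> nat \<Rightarrow> nat \<Rightarrow> int \<Rightarrow> complex" where
  "jtp_term y M N r = tcoef t r * y powi r * rqp q (int N - r) * rqp q (int M + r)"

text \<open>A Pascal-type rule: raising \<open>N\<close> multiplies the sum by
  \<open>1 - y * q ^ Suc N\<close>, the next factor of \<open>qpoch (y * q) q N\<close>. It rests on
  \<open>1 - a * b = (1 - a) + a * (1 - b)\<close>.\<close>

lemma jtp_term_Suc_right:
  assumes "y \<noteq> 0"
  shows "(1 - q powi (int M + int N + 1)) * jtp_term y M (Suc N) r
    = jtp_term y M N r + (- y * q ^ Suc N) * jtp_term y M N (r - 1)"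
proof -
  define A B C where "A = rqp q (int N + 1 - r)" and "B = rqp q (int M + r)"
    and "C = tcoef t (r - 1) * y powi (r - 1)"
  define a b Q where "a = q powi (int N + 1 - r)" and "b = q powi (int M + r)" and "Q = q powi r"
  have 1: "rqp q (int N - r) = (1 - a) * A"
    using rqp_rec[OF norm_q q_nz, of "int N + 1 - r"] by (simp add: A_def a_def algebra_simps)
  have 2: "rqp q (int M + (r - 1)) = (1 - b) * B"
    using rqp_rec[OF norm_q q_nz, of "int M + r"] by (simp add: B_def b_def algebra_simps)
  have 3: "tcoef t r * y powi r = - Q * y * C"
    using assms unfolding C_def Q_def by (subst tcoef_rec) (simp add: power_int_diff)
  have 4: "q powi (int M + int N + 1) = a * b"
    unfolding a_def b_def using q_nz by (subst power_int_add[symmetric]) (auto simp: algebra_simps)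
  have "q powi (int (Suc N)) = Q * a"
    unfolding a_def Q_def using q_nz by (subst power_int_add[symmetric]) (auto simp: algebra_simps)
  hence 5: "q ^ Suc N = Q * a"
    by (simp only: power_int_of_nat)
  have "jtp_term y M (Suc N) r = (- Q * y * C) * A * B"
    unfolding jtp_term_def 3 by (simp add: A_def B_def add.commute)
  moreover have "jtp_term y M N r = (- Q * y * C) * ((1 - a) * A) * B"
    unfolding jtp_term_def 3 1 by (simp add: B_def)
  moreover have "jtp_term y M N (r - 1) = C * A * ((1 - b) * B)"
    unfolding jtp_term_def 2 by (simp add: C_def A_def algebra_simps)
  ultimately show ?thesis unfolding 4 5 by algebra
qed

text \<open>The mirror image: raising \<open>M\<close> brings in the factor
  \<open>1 - q ^ M / y\<close> of \<open>qpoch (1 / y) q (Suc M)\<close>.\<close>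

lemma jtp_term_Suc_left:
  assumes "y \<noteq> 0"
  shows "(1 - q powi (int M + int N + 1)) * jtp_term y (Suc M) N r
    = jtp_term y M N r + (- (q ^ M) / y) * jtp_term y M N (r + 1)"
proof -
  define A B C where "A = rqp q (int N - r)" and "B = rqp q (int M + 1 + r)"
    and "C = tcoef t r * y powi r"
  define a b Q where "a = q powi (int N - r)" and "b = q powi (int M + 1 + r)" and "Q = q powi (r + 1)"
  have 1: "rqp q (int N - (r + 1)) = (1 - a) * A"
    using rqp_rec[OF norm_q q_nz, of "int N - r"] by (simp add: A_def a_def algebra_simps)
  have 2: "rqp q (int M + r) = (1 - b) * B"
    using rqp_rec[OF norm_q q_nz, of "int M + 1 + r"] by (simp add: B_def b_def algebra_simps)
  have 3: "tcoef t (r + 1) * y powi (r + 1) = - Q * y * C"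
    using assms unfolding C_def Q_def by (subst tcoef_rec) (simp add: power_int_add)
  have 4: "q powi (int M + int N + 1) = a * b"
    unfolding a_def b_def using q_nz by (subst power_int_add[symmetric]) (auto simp: algebra_simps)
  have "q powi (int M + 1 + r) = q powi (int M) * Q"
    unfolding Q_def using q_nz by (subst power_int_add[symmetric]) (auto simp: algebra_simps)
  hence 5: "b = q ^ M * Q"
    by (simp only: b_def power_int_of_nat)
  have "jtp_term y (Suc M) N r = C * A * B"
    unfolding jtp_term_def by (simp add: A_def B_def C_def add.commute add.left_commute)
  moreover have "jtp_term y M N r = C * A * ((1 - b) * B)"
    unfolding jtp_term_def 2 by (simp add: A_def C_def)
  moreover have "jtp_term y M N (r + 1) = (- Q * y * C) * ((1 - a) * A) * B"
    unfolding jtp_term_def 3 1 by (simp add: B_def algebra_simps)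
  moreover have "- (q ^ M) / y * ((- Q * y * C) * ((1 - a) * A) * B) = b * C * ((1 - a) * A) * B"
    using assms by (simp add: 5)
  ultimately show ?thesis unfolding 4 by algebra
qed

text \<open>The finite triple product. A new factor acts through a shift of \<open>r\<close>, which
  leaves a sum over all integers unchanged; the factors counted by \<open>N\<close> are built up
  first with \<open>M = 0\<close>, then those counted by \<open>M\<close>.\<close>

lemma has_sum_jtp_term:
  assumes y: "y \<noteq> 0"
  shows "(jtp_term y M N has_sum
    qpoch (y * q) q N * qpoch (1 / y) q M * rqp q (int M + int N)) UNIV"
proof (induction M)
  case 0
  show ?case
  proof (induction N)
    case 0
    show ?case
      by (rule has_sum_finite_neutralI[of "{0}"])
         (auto simp: jtp_term_def rqp_def tcoef_def)
  next
    case (Suc N)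
    let ?S = "qpoch (y * q) q N * qpoch (1 / y) q 0 * rqp q (int 0 + int N)"
    define c where "c = q powi (int 0 + int N + 1)"
    have c: "1 - c \<noteq> 0" unfolding c_def by (rule one_minus_q_powi_nz) auto
    have "((\<lambda>r. jtp_term y 0 N (r - 1)) has_sum ?S) UNIV"
      using Suc has_sum_int_shift[of "jtp_term y 0 N" "- 1"] by simp
    hence "((\<lambda>r. 1 / (1 - c) * (jtp_term y 0 N r + (- y * q ^ Suc N) * jtp_term y 0 N (r - 1))) has_sum
       1 / (1 - c) * (?S + (- y * q ^ Suc N) * ?S)) UNIV"
      by (intro has_sum_cmult_right has_sum_add Suc)
    moreover have "1 / (1 - c) * (jtp_term y 0 N r + (- y * q ^ Suc N) * jtp_term y 0 N (r - 1))
        = jtp_term y 0 (Suc N) r" for r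
      using jtp_term_Suc_right[OF y, of 0 N r] c unfolding c_def[symmetric] by (simp add: field_simps)
    moreover have R: "rqp q (int 0 + int N) = (1 - c) * rqp q (int 0 + int (Suc N))"
      using rqp_rec[OF norm_q q_nz, of "int N + 1"] by (simp add: c_def add.commute)
    have "1 / (1 - c) * (?S + (- y * q ^ Suc N) * ?S)
        = qpoch (y * q) q (Suc N) * qpoch (1 / y) q 0 * rqp q (int 0 + int (Suc N))"
      unfolding R qpoch_Suc using c by (simp add: field_simps)
    ultimately show ?case by simp
  qed
next
  case (Suc M)
  let ?S = "qpoch (y * q) q N * qpoch (1 / y) q M * rqp q (int M + int N)"
  define c where "c = q powi (int M + int N + 1)"
  have c: "1 - c \<noteq> 0" unfolding c_def by (rule one_minus_q_powi_nz) auto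
  have "((\<lambda>r. jtp_term y M N (r + 1)) has_sum ?S) UNIV"
    using Suc has_sum_int_shift[of "jtp_term y M N" 1] by simp
  hence "((\<lambda>r. 1 / (1 - c) * (jtp_term y M N r + (- (q ^ M) / y) * jtp_term y M N (r + 1))) has_sum
     1 / (1 - c) * (?S + (- (q ^ M) / y) * ?S)) UNIV"
    by (intro has_sum_cmult_right has_sum_add Suc)
  moreover have "1 / (1 - c) * (jtp_term y M N r + (- (q ^ M) / y) * jtp_term y M N (r + 1))
      = jtp_term y (Suc M) N r" for r
    using jtp_term_Suc_left[OF y, of M N r] c unfolding c_def[symmetric] by (simp add: field_simps)
  moreover have R: "rqp q (int M + int N) = (1 - c) * rqp q (int (Suc M) + int N)"
    using rqp_rec[OF norm_q q_nz, of "int M + int N + 1"] by (simp add: c_def algebra_simps)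
  have "1 / (1 - c) * (?S + (- (q ^ M) / y) * ?S)
      = qpoch (y * q) q N * qpoch (1 / y) q (Suc M) * rqp q (int (Suc M) + int N)"
    unfolding R qpoch_Suc using c y by (simp add: field_simps)
  ultimately show ?case by simp
qed

lemma summable_on_tcoef:
  assumes "y \<noteq> 0"
  shows "(\<lambda>r. norm (tcoef t r * y powi r)) summable_on UNIV"
proof -
  have "norm (tcoef t r * y powi r) = norm t powi (r * r) * (norm t * norm y) powi r" for r
  proof -
    have "norm t powi (r * (r + 1)) = norm t powi (r * r) * norm t powi r"
      using t_nz by (subst power_int_add[symmetric]) (auto simp: algebra_simps)
    thus ?thesis
      by (simp add: tcoef_def norm_mult norm_power_int power_int_mult_distrib)
  qed
  thus ?thesis
    using summable_on_quadratic[of "norm t" "norm t * norm y"] norm_t t_nz assms by simp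
qed

lemma rqp_window_LIMSEQ:
  "(\<lambda>n. rqp q (int n - r) * rqp q (int n + r)) \<longlonglongrightarrow> 1 / qpoch_inf q q ^ 2"
  using tendsto_mult[OF rqp_LIMSEQ[OF norm_q, of "- r"] rqp_LIMSEQ[OF norm_q, of r]]
  by (simp add: power2_eq_square)

lemma qq_nz: "qpoch_inf q q \<noteq> 0"
  by (rule qpoch_inf_nonzero'[OF norm_q norm_q])

text \<open>The case \<open>M = N = n\<close> of the finite form, with \<open>n\<close> tending to
  infinity. The termwise limits carry \<open>1 / qpoch_inf q q ^ 2\<close>, which is multiplied out
  at the end.\<close>

theorem jacobi_triple_product:
  assumes y: "y \<noteq> 0"
  shows "((\<lambda>r. tcoef t r * y powi r) has_sum
    qpoch_inf (y * q) q * qpoch_inf (1 / y) q * qpoch_inf q q) UNIV"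
proof -
  obtain K where K: "K > 0" "\<And>k. norm (rqp q k) \<le> K"
    using rqp_bounded[OF norm_q] by blast
  have "((\<lambda>r. tcoef t r * y powi r * (1 / qpoch_inf q q ^ 2)) has_sum
      qpoch_inf (y * q) q * qpoch_inf (1 / y) q * (1 / qpoch_inf q q)) UNIV"
  proof (rule has_sum_dominated)
    show "(jtp_term y n n has_sum qpoch (y * q) q n * qpoch (1 / y) q n * rqp q (int n + int n)) UNIV" for n
      by (rule has_sum_jtp_term[OF y])
    show "norm (jtp_term y n n r) \<le> norm (tcoef t r * y powi r) * (K * K)" for n r
      unfolding jtp_term_def using K
      by (auto simp: norm_mult mult.assoc intro!: mult_left_mono mult_mono)
    show "(\<lambda>r. norm (tcoef t r * y powi r) * (K * K)) summable_on UNIV"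
      by (intro summable_on_cmult_left summable_on_tcoef y)
    show "(\<lambda>n. jtp_term y n n r) \<longlonglongrightarrow> tcoef t r * y powi r * (1 / qpoch_inf q q ^ 2)" for r
      unfolding jtp_term_def mult.assoc[of _ "rqp q _"] by (intro tendsto_intros rqp_window_LIMSEQ)
    have "filterlim (\<lambda>n::nat. n + n) at_top sequentially"
      by (rule filterlim_subseq) (auto simp: strict_mono_def)
    hence "(\<lambda>n. rqp q (int (n + n) + 0)) \<longlonglongrightarrow> 1 / qpoch_inf q q"
      by (rule filterlim_compose[OF rqp_LIMSEQ[OF norm_q]])
    thus "(\<lambda>n. qpoch (y * q) q n * qpoch (1 / y) q n * rqp q (int n + int n)) \<longlonglongrightarrow>
        qpoch_inf (y * q) q * qpoch_inf (1 / y) q * (1 / qpoch_inf q q)"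
      by (intro tendsto_intros qpoch_LIMSEQ norm_q) simp
  qed
  from has_sum_cmult_left[OF this, of "qpoch_inf q q ^ 2"] show ?thesis
    using qq_nz by (simp add: power2_eq_square mult_ac)
qed

text \<open>The partial fraction in \<open>x\<close> of
  \<open>1 / (qpoch x q (Suc N) * qpoch (q / x) q M)\<close> with pole at
  \<open>q powi (- r)\<close>; the \<open>rqp\<close> factors vanish exactly when there is no such
  pole.\<close>

definition pf_term :: "complex \<Rightarrow> nat \<Rightarrow> nat \<Rightarrow> int \<Rightarrow> complex" where
  "pf_term x M N r = tcoef t r * rqp q (int N - r) * rqp q (int M + r) / (1 - x * q powi r)"

text \<open>Multiplying by the new linear factor returns the old partial fraction plus a multiple of
  \<open>jtp_term\<close>, in which the pole has cancelled. Those extra terms sum to zero.\<close>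

lemma has_sum_pf_term:
  assumes x: "x \<noteq> 0" "\<And>r. x * q powi r \<noteq> 1"
  shows "(pf_term x M N has_sum 1 / (qpoch x q (Suc N) * qpoch (q / x) q M)) UNIV"
proof (induction M)
  case 0
  show ?case
  proof (induction N)
    case 0
    show ?case
      by (rule has_sum_finite_neutralI[of "{0}"])
         (auto simp: pf_term_def rqp_def tcoef_def qpoch_Suc)
  next
    case (Suc N)
    let ?S = "1 / (qpoch x q (Suc N) * qpoch (q / x) q 0)"
    let ?d = "1 - x * q ^ Suc N"
    have d: "?d \<noteq> 0" using x(2)[of "int (Suc N)"] unfolding power_int_of_nat by auto
    \<comment> \<open>At \<open>y = 1 / q\<close> the product \<open>qpoch (y * q) q (Suc N)\<close>
      starts with the factor \<open>1 - 1\<close>.\<close>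
    have "(jtp_term (1 / q) 0 (Suc N) has_sum 0) UNIV"
      using has_sum_jtp_term[of "1 / q" 0 "Suc N"] q_nz by (simp add: qpoch_Suc_left)
    hence "((\<lambda>r. 1 / ?d * (q ^ Suc N * jtp_term (1 / q) 0 (Suc N) r + pf_term x 0 N r)) has_sum
        1 / ?d * (q ^ Suc N * 0 + ?S)) UNIV"
      by (intro has_sum_cmult_right has_sum_add Suc)
    moreover have "1 / ?d * (q ^ Suc N * jtp_term (1 / q) 0 (Suc N) r + pf_term x 0 N r)
        = pf_term x 0 (Suc N) r" for r
    proof -
      define A B a Q where "A = rqp q (int N + 1 - r)" and "B = rqp q (int 0 + r)"
        and "a = q powi (int N + 1 - r)" and "Q = q powi r"
      have 1: "rqp q (int N - r) = (1 - a) * A"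
        using rqp_rec[OF norm_q q_nz, of "int N + 1 - r"] by (simp add: A_def a_def algebra_simps)
      have "q powi (int (Suc N)) = Q * a"
        unfolding a_def Q_def using q_nz by (subst power_int_add[symmetric]) (auto simp: algebra_simps)
      hence 2: "q ^ Suc N = Q * a"
        by (simp only: power_int_of_nat)
      have 3: "(1 / q) powi r = 1 / Q"
        by (simp add: Q_def power_int_one_over)
      have Q: "Q \<noteq> 0" "1 - x * Q \<noteq> 0" using q_nz x(2)[of r] by (auto simp: Q_def)
      have j1: "jtp_term (1 / q) 0 (Suc N) r = tcoef t r * (1 / Q) * A * B"
        unfolding jtp_term_def 3 by (simp add: A_def B_def add.commute)
      have j2: "pf_term x 0 N r = tcoef t r * ((1 - a) * A) * B / (1 - x * Q)"
        unfolding pf_term_def 1 by (simp add: B_def Q_def)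
      have j3: "pf_term x 0 (Suc N) r = tcoef t r * A * B / (1 - x * Q)"
        unfolding pf_term_def by (simp add: A_def B_def Q_def add.commute)
      show ?thesis
        using Q d unfolding 2 j1 j2 j3 by (simp add: divide_simps) (simp add: algebra_simps)
    qed
    moreover have "1 / ?d * (q ^ Suc N * 0 + ?S) = 1 / (qpoch x q (Suc (Suc N)) * qpoch (q / x) q 0)"
      by (subst (2) qpoch_Suc) simp
    ultimately show ?case by simp
  qed
next
  case (Suc M)
  let ?S = "1 / (qpoch x q (Suc N) * qpoch (q / x) q M)"
  let ?e = "q ^ Suc M / x"
  have e: "1 - ?e \<noteq> 0"
    using x(2)[of "- int (Suc M)"] x(1) q_nz unfolding power_int_minus power_int_of_nat
    by (auto simp: field_simps)
  \<comment> \<open>Here \<open>y = 1\<close> makes \<open>qpoch (1 / y) q (Suc M)\<close>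
    vanish.\<close>
  have "(jtp_term 1 (Suc M) N has_sum 0) UNIV"
    using has_sum_jtp_term[of 1 "Suc M" N] by (simp add: qpoch_Suc_left)
  hence "((\<lambda>r. 1 / (1 - ?e) * (pf_term x M N r + (- ?e) * jtp_term 1 (Suc M) N r)) has_sum
      1 / (1 - ?e) * (?S + (- ?e) * 0)) UNIV"
    by (intro has_sum_cmult_right has_sum_add Suc)
  moreover have "1 / (1 - ?e) * (pf_term x M N r + (- ?e) * jtp_term 1 (Suc M) N r)
      = pf_term x (Suc M) N r" for r
  proof -
    define A B b Q where "A = rqp q (int N - r)" and "B = rqp q (int M + 1 + r)"
      and "b = q powi (int M + 1 + r)" and "Q = q powi r"
    have 1: "rqp q (int M + r) = (1 - b) * B"
      using rqp_rec[OF norm_q q_nz, of "int M + 1 + r"] by (simp add: B_def b_def algebra_simps)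
    have "q powi (int M + 1 + r) = q powi (int (Suc M)) * Q"
      unfolding Q_def using q_nz by (subst power_int_add[symmetric]) (auto simp: algebra_simps)
    hence 2: "b = x * ?e * Q"
      using x(1) unfolding b_def power_int_of_nat by simp
    have Q: "1 - x * Q \<noteq> 0" using x(2)[of r] by (auto simp: Q_def)
    have j1: "jtp_term 1 (Suc M) N r = tcoef t r * A * B"
      unfolding jtp_term_def by (simp add: A_def B_def add.commute add.left_commute)
    have j2: "pf_term x M N r = tcoef t r * A * ((1 - b) * B) / (1 - x * Q)"
      unfolding pf_term_def 1 by (simp add: A_def Q_def)
    have j3: "pf_term x (Suc M) N r = tcoef t r * A * B / (1 - x * Q)"
      unfolding pf_term_def by (simp add: A_def B_def Q_def add.commute add.left_commute)
    define E where "E = ?e"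
    show ?thesis
      using Q e unfolding j1 j2 j3 2 E_def[symmetric] by (simp add: divide_simps) (simp add: algebra_simps)
  qed
  moreover have "1 / (1 - ?e) * (?S + (- ?e) * 0) = 1 / (qpoch x q (Suc N) * qpoch (q / x) q (Suc M))"
    by (simp add: qpoch_Suc[of _ _ M] mult_ac)
  ultimately show ?case by (simp only:)
qed

lemma summable_on_pf:
  assumes x: "x \<noteq> 0" "\<And>r. x * q powi r \<noteq> 1" and y: "y \<noteq> 0"
  shows "(\<lambda>r. norm (tcoef t r * y powi r / (1 - x * q powi r))) summable_on UNIV"
proof -
  obtain d where d: "d > 0" "\<And>r. d \<le> norm (1 - x * q powi r)"
    using powi_pole_distance[OF norm_q q_nz x] by blast
  show ?thesis
  proof (rule Infinite_Sum.abs_summable_on_comparison_test')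
    show "(\<lambda>r. norm (tcoef t r * y powi r) * (1 / d)) summable_on UNIV"
      by (intro summable_on_cmult_left summable_on_tcoef y)
    show "norm (tcoef t r * y powi r / (1 - x * q powi r)) \<le> norm (tcoef t r * y powi r) * (1 / d)" for r
      unfolding norm_divide mult_1_right times_divide_eq_right by (intro frac_le) (use d in auto)
  qed
qed

text \<open>The limit of the finite partial fractions for \<open>M = N = n\<close>. The second
  hypothesis excludes the zeros of \<open>theta\<close>: those of its first product for
  \<open>r \<ge> 0\<close>, those of its second for \<open>r < 0\<close>.\<close>

theorem theta_partial_fractions:
  assumes x: "x \<noteq> 0" "\<And>r. x * q powi r \<noteq> 1"
  shows "((\<lambda>r. tcoef t r / (1 - x * q powi r)) has_sum qpoch_inf q q ^ 2 / theta x q) UNIV"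
proof -
  obtain K where K: "K > 0" "\<And>k. norm (rqp q k) \<le> K"
    using rqp_bounded[OF norm_q] by blast
  have nz: "qpoch_inf x q \<noteq> 0" "qpoch_inf (q / x) q \<noteq> 0"
  proof -
    show "qpoch_inf x q \<noteq> 0"
      using x(2)[of "int _"] by (intro qpoch_inf_nonzero norm_q) simp
    show "qpoch_inf (q / x) q \<noteq> 0"
    proof (rule qpoch_inf_nonzero[OF norm_q])
      fix k show "q / x * q ^ k \<noteq> 1"
        using x(2)[of "- int (Suc k)"] x(1) q_nz unfolding power_int_minus power_int_of_nat
        by (auto simp: field_simps)
    qed
  qed
  have "((\<lambda>r. tcoef t r / (1 - x * q powi r) * (1 / qpoch_inf q q ^ 2)) has_sum
      1 / (qpoch_inf x q * qpoch_inf (q / x) q)) UNIV"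
  proof (rule has_sum_dominated)
    show "(pf_term x n n has_sum 1 / (qpoch x q (Suc n) * qpoch (q / x) q n)) UNIV" for n
      by (rule has_sum_pf_term[OF x])
    show "norm (pf_term x n n r) \<le> norm (tcoef t r * 1 powi r / (1 - x * q powi r)) * (K * K)" for n r
    proof -
      have "norm (rqp q (int n - r) * rqp q (int n + r)) \<le> K * K"
        unfolding norm_mult using K by (intro mult_mono) auto
      hence "norm (tcoef t r / (1 - x * q powi r)) * norm (rqp q (int n - r) * rqp q (int n + r))
          \<le> norm (tcoef t r / (1 - x * q powi r)) * (K * K)"
        by (intro mult_left_mono) auto
      thus ?thesis by (simp add: pf_term_def norm_mult norm_divide mult_ac)
    qed
    show "(\<lambda>r. norm (tcoef t r * 1 powi r / (1 - x * q powi r)) * (K * K)) summable_on UNIV"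
      by (intro summable_on_cmult_left summable_on_pf x) auto
    show "(\<lambda>n. pf_term x n n r) \<longlonglongrightarrow> tcoef t r / (1 - x * q powi r) * (1 / qpoch_inf q q ^ 2)" for r
      using tendsto_mult[OF tendsto_const[of "tcoef t r / (1 - x * q powi r)"] rqp_window_LIMSEQ[of r]]
      by (simp add: pf_term_def mult_ac)
    show "(\<lambda>n. 1 / (qpoch x q (Suc n) * qpoch (q / x) q n)) \<longlonglongrightarrow>
        1 / (qpoch_inf x q * qpoch_inf (q / x) q)"
      using nz by (intro tendsto_intros qpoch_LIMSEQ[THEN LIMSEQ_Suc] qpoch_LIMSEQ norm_q) auto
  qed
  from has_sum_cmult_left[OF this, of "qpoch_inf q q ^ 2"] show ?thesis
    using qq_nz by (simp add: theta_def)
qed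

section \<open>Appell-Lerch expansions of the mock theta functions\<close>

text \<open>Summand of a finite Durfee rectangle identity, a limiting case of the q-Vandermonde sum;
  for \<open>k \<ge> 0\<close> the rectangle has sides \<open>m\<close> and \<open>m + k\<close>.
  The factor with \<open>int N - m\<close> cuts the sum off.\<close>

definition durfee_term :: "int \<Rightarrow> nat \<Rightarrow> int \<Rightarrow> complex" where
  "durfee_term k N m = q powi (m * (m + k)) * rqp q m * rqp q (int N - m) * rqp q (m + k)"

text \<open>The split \<open>1 - a * b = (1 - a) + a * (1 - b)\<close> again. Its second part raises
  \<open>k\<close> and lowers \<open>m\<close>, so the induction on \<open>N\<close> has to keep
  \<open>k\<close> arbitrary.\<close>

lemma durfee_term_Suc:
  "(1 - q powi (int N + 1)) * durfee_term k (Suc N) m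
    = durfee_term k N m + q powi (int N + k + 1) * durfee_term (k + 1) N (m - 1)"
proof -
  define A B C where "A = rqp q (int N + 1 - m)" and "B = rqp q m" and "C = rqp q (m + k)"
  define a b Q where "a = q powi (int N + 1 - m)" and "b = q powi m" and "Q = q powi (m * (m + k))"
  have 1: "rqp q (int N - m) = (1 - a) * A"
    using rqp_rec[OF norm_q q_nz, of "int N + 1 - m"] by (simp add: A_def a_def algebra_simps)
  have 2: "rqp q (m - 1) = (1 - b) * B"
    using rqp_rec[OF norm_q q_nz, of m] by (simp add: B_def b_def)
  have 3: "q powi (int N + 1) = a * b"
    unfolding a_def b_def using q_nz by (subst power_int_add[symmetric]) (auto simp: algebra_simps)
  have 4: "q powi (int N + k + 1) * q powi ((m - 1) * (m + k)) = a * Q"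
    unfolding a_def Q_def using q_nz
    by (subst (1 2) power_int_add[symmetric]) (auto simp: algebra_simps)
  have 5: "m - 1 + (k + 1) = m + k" "int (Suc N) - m = int N + 1 - m" "int N - (m - 1) = int N + 1 - m"
    by auto
  have d1: "durfee_term k (Suc N) m = Q * B * A * C"
    unfolding durfee_term_def 5 by (simp add: A_def B_def C_def Q_def)
  have d2: "durfee_term k N m = Q * B * ((1 - a) * A) * C"
    unfolding durfee_term_def 1 by (simp add: B_def C_def Q_def)
  have "q powi (int N + k + 1) * durfee_term (k + 1) N (m - 1)
      = (q powi (int N + k + 1) * q powi ((m - 1) * (m + k))) * ((1 - b) * B) * A * C"
    unfolding durfee_term_def 2 5 by (simp add: A_def C_def)
  hence d3: "q powi (int N + k + 1) * durfee_term (k + 1) N (m - 1) = (a * Q) * ((1 - b) * B) * A * C"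
    unfolding 4 .
  show ?thesis unfolding d1 d2 d3 3 by algebra
qed

lemma has_sum_durfee_term:
  "(durfee_term k N has_sum rqp q (int N) * rqp q (int N + k)) UNIV"
proof (induction N arbitrary: k)
  case 0
  show ?case
    by (rule has_sum_finite_neutralI[of "{0}"]) (auto simp: durfee_term_def rqp_def)
next
  case (Suc N)
  define c where "c = q powi (int N + 1)"
  have c: "1 - c \<noteq> 0" unfolding c_def by (rule one_minus_q_powi_nz) auto
  let ?S = "\<lambda>k. rqp q (int N) * rqp q (int N + k)"
  have "((\<lambda>m. durfee_term (k + 1) N (m - 1)) has_sum ?S (k + 1)) UNIV"
    using Suc[of "k + 1"] has_sum_int_shift[of "durfee_term (k + 1) N" "- 1"] by simp
  hence "((\<lambda>m. 1 / (1 - c) * (durfee_term k N m + q powi (int N + k + 1) * durfee_term (k + 1) N (m - 1)))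
      has_sum 1 / (1 - c) * (?S k + q powi (int N + k + 1) * ?S (k + 1))) UNIV"
    by (intro has_sum_cmult_right has_sum_add Suc)
  moreover have "1 / (1 - c) * (durfee_term k N m + q powi (int N + k + 1) * durfee_term (k + 1) N (m - 1))
      = durfee_term k (Suc N) m" for m
    unfolding durfee_term_Suc[symmetric] c_def[symmetric] using c by simp
  moreover have "1 / (1 - c) * (?S k + q powi (int N + k + 1) * ?S (k + 1))
      = rqp q (int (Suc N)) * rqp q (int (Suc N) + k)"
  proof -
    have 1: "rqp q (int N) = (1 - c) * rqp q (int (Suc N))"
      using rqp_rec[OF norm_q q_nz, of "int N + 1"] by (simp add: c_def add.commute)
    have 2: "rqp q (int N + k) = (1 - q powi (int N + k + 1)) * rqp q (int N + (k + 1))"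
      using rqp_rec[OF norm_q q_nz, of "int N + k + 1"] by (simp add: algebra_simps)
    have 3: "int (Suc N) + k = int N + (k + 1)" by simp
    show ?thesis unfolding 3 2 unfolding 1 using c by (simp add: field_simps)
  qed
  ultimately show ?case by (simp only:)
qed

lemma summable_on_powi_quadratic:
  "(\<lambda>m. norm (q powi (m * (m + k)))) summable_on UNIV"
proof -
  have "norm (q powi (m * (m + k))) = norm q powi (m * m) * (norm q powi k) powi m" for m
    unfolding norm_power_int power_int_mult[symmetric] using q_nz
    by (subst power_int_add[symmetric]) (auto simp: algebra_simps)
  thus ?thesis
    using summable_on_quadratic[of "norm q" "norm q powi k"] norm_q q_nz by simp
qed

text \<open>Letting \<open>N\<close> grow leaves one factor \<open>1 / qpoch_inf q q\<close> in the
  terms and two in the sum; one cancels.\<close>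

lemma has_sum_durfee:
  "((\<lambda>m. q powi (m * (m + k)) * rqp q m * rqp q (m + k)) has_sum 1 / qpoch_inf q q) UNIV"
proof -
  obtain K where K: "K > 0" "\<And>k. norm (rqp q k) \<le> K"
    using rqp_bounded[OF norm_q] by blast
  have l: "(\<lambda>n. rqp q (int n)) \<longlonglongrightarrow> 1 / qpoch_inf q q"
    using rqp_LIMSEQ[OF norm_q, of 0] by simp
  have "((\<lambda>m. q powi (m * (m + k)) * rqp q m * (1 / qpoch_inf q q) * rqp q (m + k)) has_sum
      1 / qpoch_inf q q * (1 / qpoch_inf q q)) UNIV"
  proof (rule has_sum_dominated)
    show "(durfee_term k n has_sum rqp q (int n) * rqp q (int n + k)) UNIV" for n
      by (rule has_sum_durfee_term)
    show "norm (durfee_term k n m) \<le> norm (q powi (m * (m + k))) * (K * K * K)" for n m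
    proof -
      have "norm (rqp q m) * norm (rqp q (int n - m)) * norm (rqp q (m + k)) \<le> K * K * K"
        using K by (intro mult_mono) auto
      hence "norm (q powi (m * (m + k))) * (norm (rqp q m) * norm (rqp q (int n - m)) * norm (rqp q (m + k)))
          \<le> norm (q powi (m * (m + k))) * (K * K * K)"
        by (rule mult_left_mono) simp
      thus ?thesis by (simp only: durfee_term_def norm_mult mult.assoc)
    qed
    show "(\<lambda>m. norm (q powi (m * (m + k))) * (K * K * K)) summable_on UNIV"
      by (intro summable_on_cmult_left summable_on_powi_quadratic)
    show "(\<lambda>n. durfee_term k n m) \<longlonglongrightarrow>
        q powi (m * (m + k)) * rqp q m * (1 / qpoch_inf q q) * rqp q (m + k)" for m
      unfolding durfee_term_def
      using rqp_LIMSEQ[OF norm_q, of "- m"] by (intro tendsto_intros) simp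
    show "(\<lambda>n. rqp q (int n) * rqp q (int n + k)) \<longlonglongrightarrow> 1 / qpoch_inf q q * (1 / qpoch_inf q q)"
      by (intro tendsto_intros l rqp_LIMSEQ norm_q)
  qed
  from has_sum_cmult_left[OF this, of "qpoch_inf q q"] show ?thesis
    using qq_nz by (simp add: mult_ac)
qed

text \<open>A double sum in two orders: row \<open>n\<close> is a finite partial fraction sum with
  value \<open>g n\<close>, column \<open>r\<close> is the Durfee sum with
  \<open>k = 2 * r + int e\<close>. The case \<open>e = 1\<close> serves omega and xi, the case
  \<open>e = 0\<close> serves f.\<close>

theorem appell_lerch_expansion:
  assumes x: "x \<noteq> 0" "\<And>r. x * q powi r \<noteq> 1" and e: "e \<le> 1"
  defines "g \<equiv> \<lambda>n. q ^ (n * (n + e)) / (qpoch x q (Suc n) * qpoch (q / x) q (n + e))"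
  shows "summable g"
    and "((\<lambda>r. tcoef t r * q powi (r * (r + int e)) / (1 - x * q powi r)) has_sum
      qpoch_inf q q * suminf g) UNIV"
proof -
  obtain K where K: "K > 0" "\<And>k. norm (rqp q k) \<le> K"
    using rqp_bounded[OF norm_q] by blast
  define D where "D = (\<lambda>r. tcoef t r / (1 - x * q powi r))"
  define G where "G = (\<lambda>n r. q powi (n * (n + int e)) * (D r * rqp q (n - r) * rqp q (n + int e + r)))"
  define R where "R = (\<lambda>n::int. if n < 0 then 0 else g (nat n))"
  define C where "C = (\<lambda>r. D r * q powi (r * (r + int e)) * (1 / qpoch_inf q q))"
  have row: "(G n has_sum R n) UNIV" for n
  proof (cases "n < 0")
    case True
    \<comment> \<open>The two indices add up to \<open>2 * n + int e\<close>, which is negative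
      because \<open>e \<le> 1\<close>; so one of them is negative.\<close>
    have "rqp q (n - r) = 0 \<or> rqp q (n + int e + r) = 0" for r
      using True e by (auto simp: rqp_def)
    hence "G n = (\<lambda>r. 0)" by (auto simp: G_def)
    thus ?thesis using True by (simp add: R_def)
  next
    case False
    then obtain N where N: "n = int N" by (metis nonneg_int_cases not_less)
    have "q powi (n * (n + int e)) = q ^ (N * (N + e))"
      unfolding N by (simp only: of_nat_add[symmetric] of_nat_mult[symmetric] power_int_of_nat)
    hence "R n = q powi (n * (n + int e)) * (1 / (qpoch x q (Suc N) * qpoch (q / x) q (N + e)))"
      by (simp add: R_def g_def N)
    moreover have "G n = (\<lambda>r. q powi (n * (n + int e)) * pf_term x (N + e) N r)"
      by (auto simp: G_def D_def pf_term_def N)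
    ultimately show ?thesis
      using has_sum_cmult_right[OF has_sum_pf_term[OF x, of "N + e" N]] by simp
  qed
  have col: "((\<lambda>n. G n r) has_sum C r) UNIV" for r
  proof -
    \<comment> \<open>Reindexing the column by \<open>n = m + r\<close> splits the exponent into a
      part free of \<open>m\<close> and the Durfee exponent.\<close>
    have "q powi ((m + r) * (m + r + int e)) = q powi (r * (r + int e)) * q powi (m * (m + (2 * r + int e)))" for m
      using q_nz by (subst power_int_add[symmetric]) (auto simp: algebra_simps)
    hence "G (m + r) r = D r * q powi (r * (r + int e)) *
        (q powi (m * (m + (2 * r + int e))) * rqp q m * rqp q (m + (2 * r + int e)))" for m
      by (simp add: G_def algebra_simps)
    hence "((\<lambda>m. G (m + r) r) has_sum C r) UNIV"
      unfolding C_def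
      using has_sum_cmult_right[OF has_sum_durfee[of "2 * r + int e"], of "D r * q powi (r * (r + int e))"]
      by (simp only:)
    thus ?thesis by (simp only: has_sum_int_shift[of "\<lambda>n. G n r" r])
  qed
  have D: "(\<lambda>r. norm (D r)) summable_on UNIV"
    using summable_on_pf[OF x, of 1] by (simp add: D_def)
  have "(\<lambda>(n, r). norm (q powi (n * (n + int e))) * (norm (D r) * (K * K))) summable_on UNIV \<times> UNIV"
    using K by (intro summable_on_times_norm summable_on_powi_quadratic summable_on_cmult_left D) auto
  hence abs: "(\<lambda>p. norm ((\<lambda>(n, r). G n r) p)) summable_on UNIV \<times> UNIV"
  proof (rule Infinite_Sum.abs_summable_on_comparison_test')
    fix p :: "int \<times> int"
    obtain n r where p: "p = (n, r)" by (cases p)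
    have "norm (rqp q (n - r)) * norm (rqp q (n + int e + r)) \<le> K * K"
      using K by (intro mult_mono) auto
    hence "norm (q powi (n * (n + int e))) * (norm (D r) * (norm (rqp q (n - r)) * norm (rqp q (n + int e + r))))
        \<le> norm (q powi (n * (n + int e))) * (norm (D r) * (K * K))"
      by (intro mult_left_mono) auto
    thus "norm ((\<lambda>(n, r). G n r) p)
        \<le> (\<lambda>(n, r). norm (q powi (n * (n + int e))) * (norm (D r) * (K * K))) p"
      by (simp add: p G_def norm_mult mult.assoc)
  qed
  obtain S where S: "(R has_sum S) UNIV" "(C has_sum S) UNIV"
    by (rule has_sum_fubini[of G UNIV UNIV R C]) (use abs row col in \<open>auto simp: case_prod_unfold\<close>)
  have "(R has_sum S) {0..}"
    using S(1) by (rule has_sum_cong_neutral[THEN iffD1, rotated -1]) (auto simp: R_def)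
  moreover have "bij_betw int UNIV {0..}"
    by (rule bij_betwI[of _ _ _ nat]) auto
  ultimately have "((\<lambda>n. R (int n)) has_sum S) UNIV"
    by (simp only: has_sum_reindex_bij_betw)
  hence "g sums S"
    using has_sum_imp_sums by (force simp: R_def)
  thus "summable g" and "((\<lambda>r. tcoef t r * q powi (r * (r + int e)) / (1 - x * q powi r)) has_sum
      qpoch_inf q q * suminf g) UNIV"
    using has_sum_cmult_right[OF S(2), of "qpoch_inf q q"] qq_nz
    by (auto simp: sums_iff C_def D_def mult_ac)
qed

end

section \<open>Specialisation to omega, f and xi\<close>

lemma nome_power: "norm q < 1 \<Longrightarrow> q \<noteq> 0 \<Longrightarrow> k > 0 \<Longrightarrow> nome (q ^ k) (q ^ (2 * k))"
  by unfold_locales (auto simp: norm_power power_less_one_iff power_mult[symmetric] mult.commute)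

lemma uminus_one_powi: "(- 1 :: complex) powi n = (if even n then 1 else - 1)"
  by (cases "n \<ge> 0") (auto simp: power_int_def even_nat_iff)

lemma has_sum_int_residues:
  fixes f :: "int \<Rightarrow> 'a :: topological_comm_monoid_add"
  assumes "m > 0" "\<And>j. j < m \<Longrightarrow> ((\<lambda>k. f (int m * k + int j)) has_sum S j) UNIV"
  shows "(f has_sum (\<Sum>j<m. S j)) UNIV"
proof -
  have "(f has_sum S j) {n. n mod int m = int j}" if "j < m" for j
  proof -
    have "bij_betw (\<lambda>k. int m * k + int j) UNIV {n. n mod int m = int j}"
    proof (rule bij_betwI[of _ _ _ "\<lambda>n. n div int m"])
      show "int m * (n div int m) + int j = n" if "n \<in> {n. n mod int m = int j}" for n
        using that mult_div_mod_eq[of "int m" n] by simp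
    qed (use that in auto)
    thus ?thesis
      using assms(2)[OF that] has_sum_reindex_bij_betw by fast
  qed
  hence "(f has_sum (\<Sum>j<m. S j)) (\<Union>j\<in>{..<m}. {n. n mod int m = int j})"
    by (intro sum_has_sum) auto
  moreover have "(\<Union>j\<in>{..<m}. {n. n mod int m = int j}) = UNIV"
  proof (intro equalityI subsetI)
    fix n :: int
    have "n mod int m = int (nat (n mod int m))" "nat (n mod int m) < m"
      using assms(1) by (auto simp: nat_less_iff)
    thus "n \<in> (\<Union>j\<in>{..<m}. {n. n mod int m = int j})" by blast
  qed auto
  ultimately show ?thesis by metis
qed

text \<open>Base \<open>s ^ 2\<close> and \<open>x = s\<close>: the quotient of base and
  \<open>x\<close> is again \<open>s\<close>, so the two products merge into the square in
  \<open>mock_omega\<close>.\<close>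

lemma mock_omega_expansion:
  assumes "norm s < 1" "s \<noteq> 0"
  shows "((\<lambda>r. (- 1) powi r * s powi (3 * r * (r + 1)) / (1 - s powi (2 * r + 1))) has_sum
    euler_f 2 s * mock_omega s) UNIV"
proof -
  interpret nome s "s ^ 2" by unfold_locales (use assms in auto)
  have s: "s * (s ^ 2) powi r = s powi (2 * r + 1)" for r
    using assms by (simp add: power_int_power power_int_add)
  have "s powi (2 * r + 1) \<noteq> 1" for r
    using powi_neq_1[OF assms, of "2 * r + 1"] by (metis even_plus_one_iff even_mult_iff even_numeral odd_one add_0 norm_one even_zero)
  note A = appell_lerch_expansion(2)[of s 1, unfolded s, OF assms(2) this order_refl]
  have "(s ^ 2) ^ (n * (n + 1)) / (qpoch s (s ^ 2) (Suc n) * qpoch (s ^ 2 / s) (s ^ 2) (n + 1))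
      = s ^ (2 * n * (n + 1)) / qpoch s (s ^ 2) (n + 1) ^ 2" for n
  proof -
    have "(s ^ 2) ^ (n * (n + 1)) = s ^ (2 * n * (n + 1))"
      by (simp only: power_mult[symmetric] mult.assoc)
    moreover have "s ^ 2 / s = s" by (simp add: power2_eq_square)
    ultimately show ?thesis by (simp only: Suc_eq_plus1 power2_eq_square[of "qpoch _ _ _"])
  qed
  hence "(\<Sum>n. (s ^ 2) ^ (n * (n + 1)) / (qpoch s (s ^ 2) (Suc n) * qpoch (s ^ 2 / s) (s ^ 2) (n + 1)))
      = mock_omega s"
    by (simp only: mock_omega_def)
  moreover have "tcoef s r * (s ^ 2) powi (r * (r + int 1)) = (- 1) powi r * s powi (3 * r * (r + 1))" for r
  proof -
    have "s powi (3 * r * (r + 1)) = s powi (r * (r + 1)) * (s ^ 2) powi (r * (r + int 1))"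
      unfolding q_powi using assms by (subst power_int_add[symmetric]) (auto simp: algebra_simps)
    thus ?thesis by (simp add: tcoef_def)
  qed
  ultimately show ?thesis
    using A by (simp only: euler_f_def)
qed

text \<open>Base \<open>s ^ 2\<close> and \<open>x = - 1\<close>: the first product has an
  additional factor 2, whence the half of \<open>mock_f\<close>.\<close>

lemma mock_f_expansion:
  assumes "norm s < 1" "s \<noteq> 0"
  shows "((\<lambda>r. (- 1) powi r * s powi (3 * r * r + r) / (1 + s powi (2 * r))) has_sum
    euler_f 2 s * (mock_f (s ^ 2) / 2)) UNIV"
proof -
  interpret nome s "s ^ 2" by unfold_locales (use assms in auto)
  have n1: "- 1 * (s ^ 2) powi r \<noteq> 1" for r
    using powi_neq_1[OF norm_q q_nz, of r]
    by (cases "r = 0") (simp, metis mult_minus1 norm_minus_cancel norm_one)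
  have m1: "(- 1 :: complex) \<noteq> 0" by simp
  note A = appell_lerch_expansion[of "- 1" 0, OF m1 n1 zero_le_one]
  let ?g = "\<lambda>n. (s ^ 2) ^ (n * (n + 0)) / (qpoch (- 1) (s ^ 2) (Suc n) * qpoch (s ^ 2 / - 1) (s ^ 2) (n + 0))"
  have "?g n = (s ^ 2) ^ (n ^ 2) / qpoch (- (s ^ 2)) (s ^ 2) n ^ 2 * (1 / 2)" for n
    by (simp add: qpoch_Suc_left power2_eq_square)
  moreover from this have "summable (\<lambda>n. (s ^ 2) ^ (n ^ 2) / qpoch (- (s ^ 2)) (s ^ 2) n ^ 2)"
    using A(1) summable_mult[of ?g 2] by simp
  ultimately have "suminf ?g = mock_f (s ^ 2) / 2"
    using suminf_mult2[of "\<lambda>n. (s ^ 2) ^ (n ^ 2) / qpoch (- (s ^ 2)) (s ^ 2) n ^ 2" "1 / 2"]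
    by (simp add: mock_f_def)
  moreover have "tcoef s r * (s ^ 2) powi (r * (r + int 0)) = (- 1) powi r * s powi (3 * r * r + r)" for r
  proof -
    have "s powi (3 * r * r + r) = s powi (r * (r + 1)) * (s ^ 2) powi (r * (r + int 0))"
      unfolding q_powi using assms by (subst power_int_add[symmetric]) (auto simp: algebra_simps)
    thus ?thesis by (simp add: tcoef_def)
  qed
  moreover have "1 - - 1 * (s ^ 2) powi r = 1 + s powi (2 * r)" for r
    by (simp add: q_powi)
  ultimately show ?thesis
    using A(2) by (simp only: euler_f_def)
qed

text \<open>Base \<open>q ^ 6\<close> and \<open>x = q\<close>. After the index shift the exponent
  in \<open>xi_term\<close> is \<open>6 * n * (n + 1) + 1\<close>; the odd \<open>q\<close> is kept
  outside \<open>U\<close>.\<close>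

lemma mock_xi_expansion:
  assumes "norm q < 1" "q \<noteq> 0"
  obtains U where "mock_xi q = 1 + 2 * q * U"
    and "((\<lambda>r. (- 1) powi r * q powi (9 * r * (r + 1)) / (1 - q powi (6 * r + 1))) has_sum
      euler_f 6 q * U) UNIV"
proof -
  interpret nome "q ^ 3" "q ^ 6" using nome_power[OF assms, of 3] by simp
  have q: "q * (q ^ 6) powi r = q powi (6 * r + 1)" for r
    using assms by (simp add: power_int_power power_int_add)
  have "q powi (6 * r + 1) \<noteq> 1" for r
    using powi_neq_1[OF assms, of "6 * r + 1"] by (metis norm_one dvd_add_right_iff dvd_triv_left dvd_0_right even_numeral even_mult_iff odd_one)
  note A = appell_lerch_expansion[of q 1, unfolded q, OF assms(2) this order_refl]
  let ?g = "\<lambda>n. (q ^ 6) ^ (n * (n + 1)) / (qpoch q (q ^ 6) (Suc n) * qpoch (q ^ 6 / q) (q ^ 6) (n + 1))"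
  have "q ^ 6 / q = q ^ 5" using assms(2) by (simp add: power_eq_if)
  moreover have "6 * Suc n ^ 2 - 6 * Suc n + 1 = Suc (6 * (n * (n + 1)))" for n
    by (simp add: power2_eq_square algebra_simps)
  ultimately have "xi_term (Suc n) q = q * ?g n" for n
    by (simp add: xi_term_def power_mult[symmetric])
  hence "mock_xi q = 1 + 2 * q * suminf ?g"
    unfolding mock_xi_def using suminf_mult[OF A(1), of q] by simp
  moreover have "tcoef (q ^ 3) r * (q ^ 6) powi (r * (r + int 1)) = (- 1) powi r * q powi (9 * r * (r + 1))" for r
  proof -
    have "q powi (9 * r * (r + 1)) = (q ^ 3) powi (r * (r + 1)) * (q ^ 6) powi (r * (r + int 1))"
      unfolding power_int_power using assms by (subst power_int_add[symmetric]) (auto simp: algebra_simps)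
    thus ?thesis by (simp add: tcoef_def)
  qed
  ultimately show ?thesis
    using that[of "suminf ?g"] A(2) by (simp only: euler_f_def)
qed

section \<open>The relation between xi and omega\<close>

lemma qpoch_inf_odd:
  assumes "norm q < 1" "q \<noteq> 0"
  shows "qpoch_inf q (q ^ 2) = euler_f 1 q / euler_f 2 q"
proof -
  have "euler_f 1 q = qpoch_inf q (q ^ 2) * euler_f 2 q"
    using qpoch_inf_split[of q 2 q] assms(1)
    by (simp add: euler_f_def numeral_2_eq_2)
  thus ?thesis using euler_f_nonzero[of q 2] assms by simp
qed

lemma qpoch_inf_neg:
  assumes "norm q < 1" "q \<noteq> 0"
  shows "qpoch_inf (- q) q = euler_f 2 q / euler_f 1 q"
  using qpoch_inf_mult_neg[OF assms(1), of q] euler_f_nonzero[of q 1] assms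
  by (simp add: euler_f_def field_simps)

lemma qpoch_inf_neg_odd:
  assumes "norm q < 1" "q \<noteq> 0"
  shows "qpoch_inf (- q) (q ^ 2) = euler_f 2 q ^ 2 / (euler_f 1 q * euler_f 4 q)"
proof -
  have q2: "norm (q ^ 2) < 1" using assms(1) by (simp add: norm_power power_less_one_iff)
  have "qpoch_inf q (q ^ 2) * qpoch_inf (- q) (q ^ 2) = qpoch_inf (q ^ 2) ((q ^ 2) ^ 2)"
    by (rule qpoch_inf_mult_neg[OF q2])
  also have "\<dots> = euler_f 1 (q ^ 2) / euler_f 2 (q ^ 2)"
    by (rule qpoch_inf_odd[OF q2]) (use assms in auto)
  finally have "euler_f 1 q / euler_f 2 q * qpoch_inf (- q) (q ^ 2) = euler_f 2 q / euler_f 4 q"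
    by (simp add: qpoch_inf_odd[OF assms] euler_f_power)
  thus ?thesis
    using euler_f_nonzero[OF assms(1), of 1] euler_f_nonzero[OF assms(1), of 2]
      euler_f_nonzero[OF assms(1), of 4] by (simp add: field_simps power2_eq_square)
qed

lemma odd_powi_neq_1:
  fixes q :: complex
  assumes "norm q < 1" "q \<noteq> 0"
  shows "norm (q powi (2 * k + 1)) \<noteq> 1"
  by (rule powi_neq_1[OF assms]) presburger

text \<open>Euler's pentagonal number theorem in base \<open>q ^ 6\<close>, from the triple product
  in base \<open>q ^ 18\<close> at \<open>y = 1 / q ^ 6\<close>.\<close>

lemma pentagonal:
  assumes "norm q < 1" "q \<noteq> 0"
  shows "((\<lambda>k. (- 1) powi k * q powi (3 * k * (3 * k + 1))) has_sum euler_f 6 q) UNIV"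
proof -
  interpret nome "q ^ 9" "q ^ 18" using nome_power[OF assms, of 9] by simp
  have a: "tcoef (q ^ 9) k * (1 / q ^ 6) powi k = (- 1) powi k * q powi (3 * k * (3 * k + 1))" for k
  proof -
    have "(q ^ 9) powi (k * (k + 1)) = q powi (3 * k * (3 * k + 1)) * (q ^ 6) powi k"
      unfolding power_int_power using assms
      by (subst power_int_add[symmetric]) (auto simp: algebra_simps)
    thus ?thesis using assms(2) by (simp add: tcoef_def power_int_one_over)
  qed
  have b: "1 / q ^ 6 * q ^ 18 = q ^ 12" "1 / (1 / q ^ 6) = q ^ 6"
    using assms(2) by (simp_all add: field_simps flip: power_add)
  have c: "euler_f 6 q = qpoch_inf (q ^ 12) (q ^ 18) * qpoch_inf (q ^ 6) (q ^ 18) * qpoch_inf (q ^ 18) (q ^ 18)"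
    using qpoch_inf_split[of "q ^ 6" 3 "q ^ 6"] assms
    by (simp add: euler_f_def numeral_3_eq_3 norm_power power_less_one_iff mult_ac flip: power_mult power_add)
  have "1 / q ^ 6 \<noteq> 0" using assms(2) by simp
  from jacobi_triple_product[OF this] show ?thesis
    unfolding a b c .
qed

text \<open>Modulo 3 the expansion of \<open>1 / theta q (q ^ 2)\<close> gives \<open>q * U\<close>
  plus the pentagonal series in class 0, omega in class 1, and \<open>q * U\<close> again in class
  2. The two copies of \<open>U\<close> make up \<open>mock_xi q - 1\<close>.\<close>

theorem mock_xi_eq_mock_omega:
  assumes "norm q < 1" "q \<noteq> 0"
  shows "euler_f 6 q * (mock_xi q - q ^ 2 * mock_omega (q ^ 3)) = euler_f 2 q ^ 4 / euler_f 1 q ^ 2"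
proof -
  interpret nome q "q ^ 2" by unfold_locales (use assms in auto)
  obtain U where U: "mock_xi q = 1 + 2 * q * U"
    "((\<lambda>r. (- 1) powi r * q powi (9 * r * (r + 1)) / (1 - q powi (6 * r + 1))) has_sum euler_f 6 q * U) UNIV"
    by (rule mock_xi_expansion[OF assms])
  define \<alpha> where "\<alpha> = (\<lambda>r. (- 1) powi r * q powi (9 * r * (r + 1)) / (1 - q powi (6 * r + 1)))"
  define f where "f = (\<lambda>r. tcoef q r / (1 - q * (q ^ 2) powi r))"
  have f: "f r = (- 1) powi r * q powi (r * (r + 1)) / (1 - q powi (2 * r + 1))" for r
    using assms by (simp add: f_def tcoef_def power_int_power power_int_add)
  have nz: "1 - q powi (6 * r + 1) \<noteq> 0" for r
    using odd_powi_neq_1[OF assms, of "3 * r"] by auto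
  \<comment> \<open>Class 0: with \<open>z = q powi (6 * k + 1)\<close> this is
    \<open>z / (1 - z) + 1 = 1 / (1 - z)\<close>.\<close>
  have "((\<lambda>k. q * \<alpha> k + (- 1) powi k * q powi (3 * k * (3 * k + 1))) has_sum
      q * (euler_f 6 q * U) + euler_f 6 q) UNIV"
    using U(2) by (intro has_sum_add has_sum_cmult_right pentagonal assms) (simp add: \<alpha>_def)
  moreover have "q * \<alpha> k + (- 1) powi k * q powi (3 * k * (3 * k + 1)) = f (int 3 * k + int 0)" for k
  proof -
    have "q * q powi (9 * k * (k + 1)) = q powi (3 * k * (3 * k + 1)) * q powi (6 * k + 1)"
      using assms(2) by (subst power_int_add[symmetric], simp, subst power_int_add_1'[symmetric])
        (auto simp: algebra_simps)
    hence h: "q * \<alpha> k = (- 1) powi k * (q powi (3 * k * (3 * k + 1)) * q powi (6 * k + 1)) / (1 - q powi (6 * k + 1))"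
      by (simp add: \<alpha>_def)
    show ?thesis unfolding h using nz[of k] by (simp add: f uminus_one_powi divide_simps) (simp add: algebra_simps)
  qed
  ultimately have f0: "((\<lambda>k. f (int 3 * k + int 0)) has_sum q * (euler_f 6 q * U) + euler_f 6 q) UNIV"
    by (simp only:)
  have "((\<lambda>k. - (q ^ 2) * ((- 1) powi k * (q ^ 3) powi (3 * k * (k + 1)) / (1 - (q ^ 3) powi (2 * k + 1)))) has_sum
      - (q ^ 2) * (euler_f 2 (q ^ 3) * mock_omega (q ^ 3))) UNIV"
    using assms by (intro has_sum_cmult_right mock_omega_expansion) (auto simp: norm_power power_less_one_iff)
  moreover have "- (q ^ 2) * ((- 1) powi k * (q ^ 3) powi (3 * k * (k + 1)) / (1 - (q ^ 3) powi (2 * k + 1)))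
      = f (int 3 * k + int 1)" for k
  proof -
    have "(q ^ 3) powi (2 * k + 1) = q powi (2 * (3 * k + 1) + 1)"
      unfolding power_int_power by (simp add: algebra_simps)
    moreover have "q powi ((3 * k + 1) * (3 * k + 1 + 1)) = q powi int 2 * (q ^ 3) powi (3 * k * (k + 1))"
      unfolding power_int_power using assms(2)
      by (subst power_int_add[symmetric]) (auto simp: algebra_simps)
    ultimately show ?thesis by (simp add: f uminus_one_powi)
  qed
  ultimately have f1: "((\<lambda>k. f (int 3 * k + int 1)) has_sum - (q ^ 2) * (euler_f 2 (q ^ 3) * mock_omega (q ^ 3))) UNIV"
    by (simp only:)
  \<comment> \<open>Class 2: reflection turns the exponent \<open>6 * k + 1\<close> into
    \<open>- (6 * k + 5)\<close>. The sign from inverting the denominator cancels the one from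
    \<open>(- 1) powi (- 1 - k)\<close>.\<close>
  have "((\<lambda>k. q * \<alpha> (- 1 - k)) has_sum q * (euler_f 6 q * U)) UNIV"
    using U(2) has_sum_int_reflect[of \<alpha> "- 1"] by (intro has_sum_cmult_right) (simp add: \<alpha>_def)
  moreover have "q * \<alpha> (- 1 - k) = f (int 3 * k + int 2)" for k
  proof -
    have e: "q * q powi (9 * (- 1 - k) * (- 1 - k + 1)) = q powi ((3 * k + 2) * (3 * k + 2 + 1)) * q powi (6 * (- 1 - k) + 1)"
      using assms(2) by (subst power_int_add[symmetric], simp, subst power_int_add_1'[symmetric])
        (auto simp: algebra_simps)
    have i: "6 * (- 1 - k) + 1 = - (2 * (3 * k + 2) + 1)" by simp
    define z where "z = q powi (2 * (3 * k + 2) + 1)"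
    define w where "w = q powi ((3 * k + 2) * (3 * k + 2 + 1))"
    have z: "1 - z \<noteq> 0" "z \<noteq> 0" "z - 1 \<noteq> 0"
      using odd_powi_neq_1[OF assms, of "3 * k + 2"] assms(2) by (auto simp: z_def)
    have h: "q * \<alpha> (- 1 - k) = (- 1) powi (- 1 - k) * (q powi ((3 * k + 2) * (3 * k + 2 + 1)) * q powi (6 * (- 1 - k) + 1))
        / (1 - q powi (6 * (- 1 - k) + 1))"
      unfolding \<alpha>_def e[symmetric] by simp
    have "f (int 3 * k + int 2) = (- 1) powi (3 * k + 2) * w / (1 - z)"
      by (simp add: f w_def z_def)
    moreover have "w * inverse z / (1 - inverse z) = - (w / (1 - z))"
      using z by (simp add: field_simps)
    ultimately show ?thesis
      unfolding h i power_int_minus z_def[symmetric] w_def[symmetric] by (simp add: uminus_one_powi)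
  qed
  ultimately have f2: "((\<lambda>k. f (int 3 * k + int 2)) has_sum q * (euler_f 6 q * U)) UNIV"
    by (simp only:)
  have f6: "euler_f 2 (q ^ 3) = euler_f 6 q"
    by (simp add: euler_f_power)
  define S where "S = (\<lambda>j::nat. if j = 0 then q * (euler_f 6 q * U) + euler_f 6 q
    else if j = 1 then - (q ^ 2) * (euler_f 2 (q ^ 3) * mock_omega (q ^ 3)) else q * (euler_f 6 q * U))"
  have "(f has_sum (\<Sum>j<3. S j)) UNIV"
  proof (rule has_sum_int_residues)
    fix j :: nat assume "j < 3"
    hence "j = 0 \<or> j = 1 \<or> j = 2" by auto
    thus "((\<lambda>k. f (int 3 * k + int j)) has_sum S j) UNIV"
      using f0 f1 f2 by (auto simp: S_def)
  qed auto
  moreover have "(f has_sum qpoch_inf (q ^ 2) (q ^ 2) ^ 2 / theta q (q ^ 2)) UNIV"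
    unfolding f_def
  proof (rule theta_partial_fractions[OF assms(2)])
    show "q * (q ^ 2) powi r \<noteq> 1" for r
      using odd_powi_neq_1[OF assms, of r] assms(2)
      by (auto simp: power_int_power power_int_add mult.commute)
  qed
  ultimately have "(\<Sum>j<3. S j) = qpoch_inf (q ^ 2) (q ^ 2) ^ 2 / theta q (q ^ 2)"
    using has_sum_unique by blast
  also have "theta q (q ^ 2) = (euler_f 1 q / euler_f 2 q) ^ 2"
    unfolding theta_def using assms by (simp add: power2_eq_square qpoch_inf_odd[unfolded power2_eq_square])
  also have "qpoch_inf (q ^ 2) (q ^ 2) = euler_f 2 q" by (simp add: euler_f_def)
  also have "(\<Sum>j<3. S j) = euler_f 6 q * (mock_xi q - q ^ 2 * mock_omega (q ^ 3))"
    unfolding S_def f6 by (simp add: numeral_3_eq_3 U(1) algebra_simps)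
  finally show ?thesis
    by (simp add: power_divide flip: power_add)
qed

section \<open>Watson's relation\<close>

lemma powi_mult3:
  fixes x :: "'a :: field"
  shows "x \<noteq> 0 \<Longrightarrow> x powi a * x powi b * x powi c = x powi (a + b + c)"
  by (simp add: power_int_add)

lemma has_sum_diff:
  fixes f g :: "'a \<Rightarrow> 'b :: real_normed_field"
  assumes "(f has_sum a) A" "(g has_sum b) A"
  shows "((\<lambda>x. f x - g x) has_sum a - b) A"
  using has_sum_add[OF assms(1) has_sum_cmult_right[OF assms(2), of "- 1"]] by simp

lemma theta_shift_int':
  assumes "norm q < 1" "q = t ^ 2" "t \<noteq> 0" "x \<noteq> 0"
  shows "1 / theta (q powi j * x) q = (- x) powi j * t powi (j * (j - 1)) / theta x q"
proof -
  have nz: "(- x) powi j * t powi (j * (j - 1)) \<noteq> 0"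
    using assms by simp
  show ?thesis
    unfolding theta_shift_int[OF assms, of j, symmetric] using nz by simp
qed

lemma ii_powi_even: "\<i> powi (2 * n) = (- 1) powi n" "(- \<i>) powi (2 * n) = (- 1) powi n"
  by (simp_all add: power_int_mult)

text \<open>The product of two expansions is a double sum \<open>S\<close>. A part
  \<open>S1\<close>, summed over \<open>j\<close> first, yields \<open>mock_omega q\<close>; the
  rest, summed over \<open>i\<close> first, yields \<open>mock_f (q ^ 8)\<close> from even
  \<open>j\<close> and \<open>mock_omega (- (q ^ 4))\<close> from odd \<open>j\<close>.\<close>

theorem watson_mock_theta:
  assumes "norm q < 1" "q \<noteq> 0"
  shows "mock_f (q ^ 8) + 2 * q * mock_omega q + 2 * q ^ 3 * mock_omega (- (q ^ 4))
    = euler_f 2 q * euler_f 4 q ^ 6 / (euler_f 1 q ^ 2 * euler_f 8 q ^ 4)"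
proof -
  interpret A: nome q "q ^ 2" by unfold_locales (use assms in auto)
  interpret B: nome "q ^ 2" "q ^ 4" using nome_power[OF assms, of 2] by simp
  define d where "d = (\<lambda>i::int. q powi (2 * i + 1))"
  \<comment> \<open>A square root of \<open>(q ^ 4) powi j\<close>, so that
    \<open>1 + d i ^ 2 / e j ^ 2\<close> later factors over \<open>\<i>\<close> into denominators of
    base \<open>q ^ 2\<close>.\<close>
  define e where "e = (\<lambda>j::int. q powi (2 * j))"
  define C where "C = (\<lambda>i. tcoef q i / (1 - d i))"
  define E where "E = (\<lambda>j. tcoef (q ^ 2) j / (1 + e j ^ 2))"
  define \<rho> where "\<rho> = qpoch_inf (- (q ^ 2)) (q ^ 4)"
  have d_nz: "d i \<noteq> 0" "1 - d i \<noteq> 0" for i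
    using assms(2) odd_powi_neq_1[OF assms, of i] by (auto simp: d_def)
  have e_nz: "e j \<noteq> 0" for j using assms(2) by (simp add: e_def)
  have neg_neq_1: "- z \<noteq> 1" if "norm z \<noteq> 1" for z :: complex
    using that by (metis norm_minus_cancel norm_one)
  have e2: "e j ^ 2 = (q ^ 4) powi j" for j
    by (simp add: e_def power_int_power power_int_power' mult.commute)
  have d2: "d i ^ 2 = q powi (4 * i + 2)" for i
    by (simp add: d_def power_int_power' algebra_simps)
  have m1: "- 1 * (q ^ 4) powi j \<noteq> 1" for j
    using powi_neq_1[OF B.norm_q B.q_nz, of j] neg_neq_1[of "(q ^ 4) powi j"]
    by (cases "j = 0") auto
  have e2_nz: "1 + e j ^ 2 \<noteq> 0" for j
    using m1[of j] by (auto simp: e2 add_eq_0_iff)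
  \<comment> \<open>The quotient depends on \<open>j - i\<close> only, so a single pole distance
    \<open>\<delta>\<close> bounds all mixed denominators from below.\<close>
  have ed: "e j ^ 2 / d i ^ 2 = q powi (- 2) * (q ^ 4) powi (j - i)" for i j
  proof -
    have "(q ^ 4) powi j = q powi (- 2) * (q ^ 4) powi (j - i) * q powi (4 * i + 2)"
      unfolding power_int_power using assms(2)
      by (subst powi_mult3) auto
    thus ?thesis unfolding e2 d2 using assms(2) by simp
  qed
  have pole: "- (q powi (- 2)) * (q ^ 4) powi k \<noteq> 1" for k
  proof -
    have "q powi (- 2) * (q ^ 4) powi k = q powi (4 * k - 2)"
      unfolding power_int_power using assms(2) by (subst power_int_add[symmetric]) auto
    moreover have "4 * k - 2 \<noteq> 0" by presburger
    ultimately have "norm (q powi (- 2) * (q ^ 4) powi k) \<noteq> 1"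
      using powi_neq_1[OF assms, of "4 * k - 2"] by metis
    thus ?thesis using neg_neq_1 by simp
  qed
  have "- (q powi (- 2)) \<noteq> 0" using assms(2) by simp
  then obtain \<delta> where \<delta>: "\<delta> > 0" "\<And>k. \<delta> \<le> norm (1 - - (q powi (- 2)) * (q ^ 4) powi k)"
    using powi_pole_distance[OF B.norm_q B.q_nz _ pole] by blast
  have ed_ge: "\<delta> \<le> norm (1 + e j ^ 2 / d i ^ 2)" for i j
    using \<delta>(2)[of "j - i"] by (simp add: ed)
  have ed_nz: "1 + e j ^ 2 / d i ^ 2 \<noteq> 0" for i j
    using \<delta>(1) ed_ge[of j i] by auto

  have q_odd: "q * (q ^ 2) powi r = d r" for r
    using assms(2) by (simp add: power_int_power power_int_add d_def)
  have q_odd_neq: "q * (q ^ 2) powi r \<noteq> 1" for r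
    using d_nz(2)[of r] by (simp add: q_odd)
  have Csum: "(C has_sum euler_f 2 q ^ 2 / theta q (q ^ 2)) UNIV"
    using A.theta_partial_fractions[OF assms(2) q_odd_neq] by (simp add: C_def q_odd euler_f_def)
  have m1_nz: "(- 1 :: complex) \<noteq> 0" by simp
  have Esum: "(E has_sum euler_f 4 q ^ 2 / theta (- 1) (q ^ 4)) UNIV"
    using B.theta_partial_fractions[OF m1_nz m1] by (simp add: E_def e2 euler_f_def)
  have Cabs: "(\<lambda>i. norm (C i)) summable_on UNIV"
    using A.summable_on_pf[OF assms(2) q_odd_neq, of 1] by (simp add: C_def q_odd)
  have Eabs: "(\<lambda>j. norm (E j)) summable_on UNIV"
    using B.summable_on_pf[OF m1_nz m1, of 1] by (simp add: E_def e2)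
  have Tabs: "(\<lambda>j. norm (tcoef (q ^ 2) j)) summable_on UNIV"
    using B.summable_on_tcoef[of 1] by simp

  \<comment> \<open>\<open>P\<close> is split by the partial fractions of \<open>1 / ((1 - z d) (1 + z\<^sup>2 e\<^sup>2))\<close> in \<open>z\<close>, taken at \<open>z = 1\<close>.
    The inner sums of both parts are again expansions of \<open>1/\<theta>\<close>.\<close>
  define P where "P = (\<lambda>(i, j). C i * E j)"
  define P1 where "P1 = (\<lambda>(i, j). C i * (tcoef (q ^ 2) j / (1 + e j ^ 2 / d i ^ 2)))"
  define P2 where "P2 = (\<lambda>(i, j). E j * (tcoef q i * (1 + d i) / (1 + d i ^ 2 / e j ^ 2)))"
  have split: "P p - P1 p = P2 p" for p
  proof -
    obtain i j where p: "p = (i, j)" by (cases p)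
    have nz: "d i ^ 2 + e j ^ 2 \<noteq> 0"
      using ed_nz[of j i] d_nz(1)[of i] by (auto simp: field_simps)
    have 1: "1 / (1 + e j ^ 2 / d i ^ 2) = d i ^ 2 / (d i ^ 2 + e j ^ 2)"
      "1 / (1 + d i ^ 2 / e j ^ 2) = e j ^ 2 / (d i ^ 2 + e j ^ 2)"
      using nz d_nz(1)[of i] e_nz[of j] by (simp_all add: divide_simps add.commute)
    have 2: "1 / (1 - d i) * (1 / (1 + e j ^ 2)) - 1 / (1 - d i) * (d i ^ 2 / (d i ^ 2 + e j ^ 2))
        = 1 / (1 + e j ^ 2) * ((1 + d i) * (e j ^ 2 / (d i ^ 2 + e j ^ 2)))"
      using nz d_nz(2)[of i] e2_nz[of j]
      by (simp add: divide_simps) (simp add: algebra_simps power2_eq_square)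
    have "P p - P1 p = tcoef q i * tcoef (q ^ 2) j *
        (1 / (1 - d i) * (1 / (1 + e j ^ 2)) - 1 / (1 - d i) * (1 / (1 + e j ^ 2 / d i ^ 2)))"
      by (simp add: p P_def P1_def C_def E_def algebra_simps)
    also have "\<dots> = tcoef q i * tcoef (q ^ 2) j *
        (1 / (1 + e j ^ 2) * ((1 + d i) * (1 / (1 + d i ^ 2 / e j ^ 2))))"
      unfolding 1 2 ..
    also have "\<dots> = P2 p"
      by (simp add: p P2_def E_def)
    finally show ?thesis .
  qed

  have Pabs: "(\<lambda>p. norm (P p)) summable_on UNIV \<times> UNIV"
    using summable_on_times_norm[OF Cabs Eabs]
    by (simp add: P_def case_prod_unfold norm_mult)
  have P1abs: "(\<lambda>p. norm (P1 p)) summable_on UNIV \<times> UNIV"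
  proof (rule Infinite_Sum.abs_summable_on_comparison_test')
    show "(\<lambda>(i, j). norm (C i) * (norm (tcoef (q ^ 2) j) * (1 / \<delta>))) summable_on UNIV \<times> UNIV"
      using \<delta>(1) by (intro summable_on_times_norm summable_on_cmult_left Cabs Tabs) auto
    fix p :: "int \<times> int"
    obtain i j where p: "p = (i, j)" by (cases p)
    have "norm (tcoef (q ^ 2) j) / norm (1 + e j ^ 2 / d i ^ 2) \<le> norm (tcoef (q ^ 2) j) / \<delta>"
      using \<delta>(1) ed_ge by (intro frac_le) auto
    hence "norm (C i) * (norm (tcoef (q ^ 2) j) / norm (1 + e j ^ 2 / d i ^ 2)) \<le> norm (C i) * (norm (tcoef (q ^ 2) j) / \<delta>)"
      by (intro mult_left_mono) auto
    thus "norm (P1 p) \<le> (\<lambda>(i, j). norm (C i) * (norm (tcoef (q ^ 2) j) * (1 / \<delta>))) p"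
      by (simp add: p P1_def norm_mult norm_divide)
  qed
  obtain S where S: "(P has_sum S) (UNIV \<times> UNIV)"
    using abs_summable_summable[OF Pabs] by (auto simp: summable_on_def)
  obtain S1 where S1: "(P1 has_sum S1) (UNIV \<times> UNIV)"
    using abs_summable_summable[OF P1abs] by (auto simp: summable_on_def)
  have S2: "(P2 has_sum S - S1) (UNIV \<times> UNIV)"
    using has_sum_diff[OF S S1] by (simp only: split)

  have "((\<lambda>i. C i * (euler_f 4 q ^ 2 / theta (- 1) (q ^ 4))) has_sum S) UNIV"
    by (rule has_sum_SigmaD[OF S]) (use has_sum_cmult_right[OF Esum] in \<open>auto simp: P_def\<close>)
  hence S_eq: "S = euler_f 2 q ^ 2 / theta q (q ^ 2) * (euler_f 4 q ^ 2 / theta (- 1) (q ^ 4))"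
    using has_sum_cmult_left[OF Csum] has_sum_unique by blast

  have theta_\<rho>: "theta (- (q ^ 2)) (q ^ 4) = \<rho> ^ 2"
    using assms(2) by (simp add: theta_def \<rho>_def power2_eq_square power4_eq_xxxx)
  have S1_eq: "S1 = euler_f 4 q ^ 2 / \<rho> ^ 2 * (q * (euler_f 2 q * mock_omega q))"
  proof -
    \<comment> \<open>For fixed \<open>i\<close> this is the expansion of \<open>1 / theta\<close>
      at \<open>- 1 / d i ^ 2\<close>; a shift by a power of \<open>q ^ 4\<close> moves the argument
      to \<open>- (q ^ 2)\<close>, where \<open>theta\<close> is \<open>\<rho> ^ 2\<close>.\<close>
    have row: "((\<lambda>j. P1 (i, j)) has_sum C i * (euler_f 4 q ^ 2 * (q powi (2 * (i + 1) ^ 2) / \<rho> ^ 2))) UNIV" for i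
    proof -
      have nz: "- 1 / d i ^ 2 \<noteq> 0" using d_nz by simp
      have 1: "1 - - 1 / d i ^ 2 * (q ^ 4) powi j = 1 + e j ^ 2 / d i ^ 2" for j
        by (simp add: e2)
      have 2: "- 1 / d i ^ 2 * (q ^ 4) powi j \<noteq> 1" for j
        using ed_nz[of j i] unfolding 1[symmetric] by (metis right_minus_eq)
      have "- 1 / d i ^ 2 = (q ^ 4) powi (- i - 1) * (- (q ^ 2))"
      proof -
        have "(q ^ 4) powi (- i - 1) * q powi int 2 * q powi (4 * i + 2) = q powi 0"
          unfolding power_int_power using assms(2)
          by (subst powi_mult3) auto
        thus ?thesis unfolding d2 using assms(2) by (simp add: field_simps)
      qed
      hence "1 / theta (- 1 / d i ^ 2) (q ^ 4)
          = (- (- (q ^ 2))) powi (- i - 1) * (q ^ 2) powi ((- i - 1) * (- i - 1 - 1)) / theta (- (q ^ 2)) (q ^ 4)"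
        using theta_shift_int'[OF B.norm_q B.q_eq B.t_nz, of "- (q ^ 2)" "- i - 1"] assms(2) by simp
      also have "(- (- (q ^ 2))) powi (- i - 1) * (q ^ 2) powi ((- i - 1) * (- i - 1 - 1)) = q powi (2 * (i + 1) ^ 2)"
        unfolding minus_minus power_int_power using assms(2)
        by (subst power_int_add[symmetric]) (auto simp: algebra_simps power2_eq_square)
      finally have 3: "1 / theta (- 1 / d i ^ 2) (q ^ 4) = q powi (2 * (i + 1) ^ 2) / \<rho> ^ 2"
        by (simp only: theta_\<rho>)
      have "((\<lambda>j. tcoef (q ^ 2) j / (1 + e j ^ 2 / d i ^ 2)) has_sum
          euler_f 4 q ^ 2 * (1 / theta (- 1 / d i ^ 2) (q ^ 4))) UNIV"
        using B.theta_partial_fractions[OF nz 2] unfolding 1 by (simp add: euler_f_def)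
      thus ?thesis
        unfolding 3 P1_def prod.case by (rule has_sum_cmult_right)
    qed
    have R1: "((\<lambda>i. C i * (euler_f 4 q ^ 2 * (q powi (2 * (i + 1) ^ 2) / \<rho> ^ 2))) has_sum S1) UNIV"
      by (rule has_sum_SigmaD[OF S1]) (use row in auto)
    interpret T: nome "q ^ 3" "q ^ 6" using nome_power[OF assms, of 3] by simp
    have "qpoch_inf 1 (q ^ 6) = 0"
      using qpoch_inf_rec[OF T.norm_q, of 1] by simp
    \<comment> \<open>The row values carry \<open>d i / (1 - d i) = 1 / (1 - d i) - 1\<close>; the
      part with \<open>- 1\<close> is this theta series of sum 0.\<close>
    hence Z: "(tcoef (q ^ 3) has_sum 0) UNIV"
      using T.jacobi_triple_product[of 1] by simp
    have "((\<lambda>i. euler_f 4 q ^ 2 / \<rho> ^ 2 * (q * ((- 1) powi i * q powi (3 * i * (i + 1)) / (1 - q powi (2 * i + 1)) - tcoef (q ^ 3) i)))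
        has_sum euler_f 4 q ^ 2 / \<rho> ^ 2 * (q * (euler_f 2 q * mock_omega q - 0))) UNIV"
      by (intro has_sum_cmult_right has_sum_diff mock_omega_expansion assms Z)
    moreover have "euler_f 4 q ^ 2 / \<rho> ^ 2 * (q * ((- 1) powi i * q powi (3 * i * (i + 1)) / (1 - q powi (2 * i + 1)) - tcoef (q ^ 3) i))
        = C i * (euler_f 4 q ^ 2 * (q powi (2 * (i + 1) ^ 2) / \<rho> ^ 2))" for i
    proof -
      have 1: "tcoef (q ^ 3) i = (- 1) powi i * q powi (3 * i * (i + 1))"
        by (simp add: tcoef_def power_int_power mult.assoc)
      have "q powi (i * (i + 1)) * q powi (2 * (i + 1) ^ 2) = q powi 1 * q powi (3 * i * (i + 1)) * d i"
        unfolding d_def using assms(2)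
        by (subst power_int_add[symmetric], simp, subst powi_mult3) (auto simp: algebra_simps power2_eq_square)
      hence 2: "q powi (i * (i + 1)) * q powi (2 * (i + 1) ^ 2) = q * q powi (3 * i * (i + 1)) * d i"
        by simp
      have "C i * q powi (2 * (i + 1) ^ 2) = (- 1) powi i * (q powi (i * (i + 1)) * q powi (2 * (i + 1) ^ 2)) / (1 - d i)"
        by (simp add: C_def tcoef_def)
      also have "\<dots> = q * ((- 1) powi i * q powi (3 * i * (i + 1)) / (1 - d i) - tcoef (q ^ 3) i)"
        unfolding 1 2 using d_nz(2)[of i] by (simp add: divide_simps) (simp add: algebra_simps)
      finally show ?thesis
        by (simp add: d_def mult_ac)
    qed
    ultimately have "((\<lambda>i. C i * (euler_f 4 q ^ 2 * (q powi (2 * (i + 1) ^ 2) / \<rho> ^ 2))) has_sum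
       euler_f 4 q ^ 2 / \<rho> ^ 2 * (q * (euler_f 2 q * mock_omega q - 0))) UNIV"
      by (simp only:)
    thus ?thesis using R1 has_sum_unique by fastforce
  qed

  define \<kappa> where "\<kappa> = euler_f 2 q ^ 2 / \<rho>"
  have S2_eq: "S - S1 = \<kappa> * (euler_f 8 q * (mock_f (q ^ 8) / 2)) + \<kappa> * (q ^ 3 * (euler_f 8 q * mock_omega (- (q ^ 4))))"
  proof -
    \<comment> \<open>Both square roots of \<open>- 1\<close> lead to the same
      \<open>\<rho>\<close>, because \<open>u * q\<close> and \<open>q ^ 2 / (u * q)\<close> are
      negatives of each other.\<close>
    have inner: "((\<lambda>i. tcoef q i / (1 - u * (d i / e j))) has_sum \<kappa> * (u powi j * q powi (j ^ 2))) UNIV"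
      if u: "u = \<i> \<or> u = - \<i>" for u j
    proof -
      have u0: "u \<noteq> 0" "norm u = 1" "u * u = - 1" using u by auto
      have nz: "u * q / e j \<noteq> 0" using u0 assms(2) e_nz by simp
      have x: "u * q / e j * (q ^ 2) powi r = u * (d r / e j)" for r
        by (simp flip: q_odd)
      have de: "d r / e j = q powi (2 * (r - j) + 1)" for r
        unfolding d_def e_def using assms(2) by (simp add: power_int_diff[symmetric] algebra_simps)
      have ne: "u * q / e j * (q ^ 2) powi r \<noteq> 1" for r
      proof -
        have "norm (u * (d r / e j)) \<noteq> 1"
          unfolding de norm_mult u0 using odd_powi_neq_1[OF assms, of "r - j"] by (simp only: mult_1 not_False_eq_True)
        thus ?thesis unfolding x by (metis norm_one)
      qed
      have xe: "u * q / e j = (q ^ 2) powi (- j) * (u * q)"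
        by (simp add: e_def power_int_power power_int_minus field_simps)
      have th: "theta (u * q) (q ^ 2) = \<rho>"
      proof -
        have "q ^ 2 / (u * q) = - (u * q)"
          using u0 assms(2) by (simp add: field_simps power2_eq_square)
        hence "theta (u * q) (q ^ 2) = qpoch_inf ((u * q) ^ 2) ((q ^ 2) ^ 2)"
          using qpoch_inf_mult_neg[OF A.norm_q, of "u * q"] by (simp add: theta_def)
        thus ?thesis using u0 by (simp add: \<rho>_def power2_eq_square power4_eq_xxxx mult_ac)
      qed
      have "u * q \<noteq> 0" using u0 assms(2) by simp
      from theta_shift_int'[OF A.norm_q refl A.t_nz this, of "- j"]
      have "1 / theta (u * q / e j) (q ^ 2) = (- (u * q)) powi (- j) * q powi (- j * (- j - 1)) / \<rho>"
        unfolding xe th .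
      also have "(- (u * q)) powi (- j) * q powi (- j * (- j - 1)) = u powi j * q powi (j ^ 2)"
      proof -
        have "- (u * q) = inverse u * q"
          using u0 by (simp add: field_simps)
        hence "(- (u * q)) powi (- j) = u powi j * q powi (- j)"
          by (simp add: power_int_mult_distrib power_int_inverse power_int_minus)
        moreover have "q powi (- j) * q powi (- j * (- j - 1)) = q powi (j ^ 2)"
          using assms(2) by (subst power_int_add[symmetric]) (auto simp: algebra_simps power2_eq_square)
        ultimately show ?thesis by simp
      qed
      finally have "1 / theta (u * q / e j) (q ^ 2) = u powi j * q powi (j ^ 2) / \<rho>" .
      moreover have "((\<lambda>i. tcoef q i / (1 - u * (d i / e j))) has_sum
          euler_f 2 q ^ 2 * (1 / theta (u * q / e j) (q ^ 2))) UNIV"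
        using A.theta_partial_fractions[OF nz ne] unfolding x by (simp add: euler_f_def)
      ultimately show ?thesis by (simp add: \<kappa>_def)
    qed
    \<comment> \<open>The weights come from the partial fractions of
      \<open>(1 + w * e j) / (1 + w ^ 2)\<close> in \<open>w = d i / e j\<close>.\<close>
    define R where "R = (\<lambda>j. E j * (((1 - \<i> * e j) / 2) * (\<kappa> * (\<i> powi j * q powi (j ^ 2)))
        + ((1 + \<i> * e j) / 2) * (\<kappa> * ((- \<i>) powi j * q powi (j ^ 2)))))"
    have col: "((\<lambda>i. P2 (i, j)) has_sum R j) UNIV" for j
    proof -
      have "((\<lambda>i. E j * (((1 - \<i> * e j) / 2) * (tcoef q i / (1 - \<i> * (d i / e j)))
          + ((1 + \<i> * e j) / 2) * (tcoef q i / (1 - (- \<i>) * (d i / e j))))) has_sum R j) UNIV"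
        unfolding R_def by (intro has_sum_cmult_right has_sum_add inner) auto
      moreover have "E j * (((1 - \<i> * e j) / 2) * (tcoef q i / (1 - \<i> * (d i / e j)))
          + ((1 + \<i> * e j) / 2) * (tcoef q i / (1 - (- \<i>) * (d i / e j)))) = P2 (i, j)" for i
      proof -
        define w where "w = d i / e j"
        have "d i = w * e j" using e_nz[of j] by (simp add: w_def)
        have "d i ^ 2 + e j ^ 2 \<noteq> 0"
          using ed_nz[of j i] d_nz(1)[of i] by (auto simp: field_simps)
        hence w0: "1 + w ^ 2 \<noteq> 0"
          using e_nz[of j] by (auto simp: w_def field_simps)
        moreover have w: "1 + w ^ 2 = (1 - \<i> * w) * (1 + \<i> * w)"
          by (simp add: algebra_simps power2_eq_square)
        ultimately have nz: "1 - \<i> * w \<noteq> 0" "1 + \<i> * w \<noteq> 0" by auto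
        have "((1 - \<i> * e j) / 2) * (1 / (1 - \<i> * w)) + ((1 + \<i> * e j) / 2) * (1 / (1 + \<i> * w))
            = (1 + d i) / (1 + w ^ 2)"
        proof -
          have add: "a / 2 * (1 / A) + b / 2 * (1 / B) = (a * B + b * A) / 2 / (A * B)"
            if "A \<noteq> 0" "B \<noteq> 0" for a b A B :: complex
            using that by (simp add: field_simps)
          have num: "(1 - \<i> * e j) * (1 + \<i> * w) + (1 + \<i> * e j) * (1 - \<i> * w) = 2 * (1 + d i)"
            unfolding \<open>d i = w * e j\<close> by (simp add: algebra_simps)
          show ?thesis unfolding add[OF nz] num w by (simp del: distrib_left_numeral)
        qed
        hence "tcoef q i * (((1 - \<i> * e j) / 2) * (1 / (1 - \<i> * w)) + ((1 + \<i> * e j) / 2) * (1 / (1 + \<i> * w)))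
            = tcoef q i * ((1 + d i) / (1 + w ^ 2))"
          by (rule arg_cong)
        thus ?thesis
          unfolding P2_def prod.case w_def[symmetric] power_divide[symmetric]
          by (simp add: algebra_simps)
      qed
      ultimately show ?thesis by (simp only:)
    qed
    have "((\<lambda>(j, i). P2 (i, j)) has_sum S - S1) (UNIV \<times> UNIV)"
      using S2 has_sum_swap[of P2 UNIV UNIV "S - S1"] by simp
    hence RS: "(R has_sum S - S1) UNIV"
      by (rule has_sum_SigmaD) (use col in auto)

    have Ej: "E j = (- 1) powi j * q powi (2 * j * (j + 1)) / (1 + q powi (4 * j))" for j
      by (simp add: E_def tcoef_def e2 power_int_power mult.assoc)
    \<comment> \<open>For even \<open>j\<close> the powers of \<open>\<i>\<close> and
      \<open>- \<i>\<close> agree, and the two weights add up to 1.\<close>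
    have "((\<lambda>n. \<kappa> * ((- 1) powi n * (q ^ 4) powi (3 * n * n + n) / (1 + (q ^ 4) powi (2 * n)))) has_sum
        \<kappa> * (euler_f 2 (q ^ 4) * (mock_f ((q ^ 4) ^ 2) / 2))) UNIV"
      using assms by (intro has_sum_cmult_right mock_f_expansion) (auto simp: norm_power power_less_one_iff)
    moreover have "\<kappa> * ((- 1) powi n * (q ^ 4) powi (3 * n * n + n) / (1 + (q ^ 4) powi (2 * n)))
        = R (int 2 * n + int 0)" for n
    proof -
      have "q powi (2 * (2 * n) * (2 * n + 1)) * q powi ((2 * n) ^ 2) = (q ^ 4) powi (3 * n * n + n)"
        unfolding power_int_power using assms(2)
        by (subst power_int_add[symmetric]) (auto simp: algebra_simps power2_eq_square)
      hence "E (2 * n) * q powi ((2 * n) ^ 2) = (q ^ 4) powi (3 * n * n + n) / (1 + q powi (4 * (2 * n)))"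
        unfolding Ej by (simp add: uminus_one_powi)
      moreover have "R (int 2 * n + int 0) = \<kappa> * (- 1) powi n * (E (2 * n) * q powi ((2 * n) ^ 2))"
      proof -
        have i: "int 2 * n + int 0 = 2 * n" by simp
        show ?thesis unfolding R_def i ii_powi_even by (simp add: field_simps)
      qed
      ultimately show ?thesis by (simp add: power_int_power)
    qed
    ultimately have R0: "((\<lambda>n. R (int 2 * n + int 0)) has_sum \<kappa> * (euler_f 8 q * (mock_f (q ^ 8) / 2))) UNIV"
      by (simp add: euler_f_power flip: power_mult)

    \<comment> \<open>For odd \<open>j\<close> the weights combine to \<open>e j\<close>, up to
      sign. The denominator \<open>1 + z\<close> matches that of omega at \<open>- (q ^ 4)\<close>
      after reflecting \<open>n\<close> to \<open>- 1 - n\<close>.\<close>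
    define H where "H = (\<lambda>n. (- 1) powi n * (- (q ^ 4)) powi (3 * n * (n + 1)) / (1 - (- (q ^ 4)) powi (2 * n + 1)))"
    have "(H has_sum euler_f 2 (- (q ^ 4)) * mock_omega (- (q ^ 4))) UNIV"
      unfolding H_def using assms by (intro mock_omega_expansion) (auto simp: norm_power power_less_one_iff)
    hence "((\<lambda>n. \<kappa> * (q ^ 3 * H (- 1 - n))) has_sum \<kappa> * (q ^ 3 * (euler_f 2 (- (q ^ 4)) * mock_omega (- (q ^ 4))))) UNIV"
      using has_sum_int_reflect[of H "- 1"] by (intro has_sum_cmult_right) simp
    moreover have "\<kappa> * (q ^ 3 * H (- 1 - n)) = R (int 2 * n + int 1)" for n
    proof -
      define m where "m = 2 * n + 1"
      define z where "z = q powi (4 * m)"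
      have z: "z \<noteq> 0" "1 + z \<noteq> 0"
        using assms(2) e2_nz[of m] by (auto simp: z_def e2 power_int_power)
      have 1: "(- (q ^ 4)) powi (3 * (- 1 - n) * (- 1 - n + 1)) = q powi (12 * n * (n + 1))"
      proof -
        have ev: "3 * (- 1 - n) * (- 1 - n + 1) = 3 * n * (n + 1)" "even (3 * n * (n + 1))"
          by (auto simp: algebra_simps)
        thus ?thesis unfolding ev(1) by (simp add: power_int_minus_left power_int_power mult.assoc)
      qed
      have 2: "(- (q ^ 4)) powi (2 * (- 1 - n) + 1) = - inverse z"
      proof -
        have ev: "2 * (- 1 - n) + 1 = - m" "odd (- m)" by (auto simp: m_def)
        thus ?thesis unfolding ev(1)
          by (simp add: power_int_minus_left power_int_power z_def power_int_minus)
      qed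
      have "q powi (int 3) * q powi (12 * n * (n + 1)) * z = q powi (2 * m * (m + 1)) * q powi (m ^ 2) * e m"
        unfolding z_def e_def m_def using assms(2)
        by (subst (1 2) powi_mult3) (auto simp: algebra_simps power2_eq_square)
      hence 3: "q ^ 3 * q powi (12 * n * (n + 1)) * z = q powi (2 * m * (m + 1)) * q powi (m ^ 2) * e m"
        by (simp only: power_int_of_nat)
      have s: "(- 1 :: complex) powi (- 1 - n) = - ((- 1) powi n)"
        by (simp add: uminus_one_powi)
      have "H (- 1 - n) = - ((- 1) powi n * q powi (12 * n * (n + 1)) * (z / (1 + z)))"
        unfolding H_def 1 2 s using z by (simp add: field_simps)
      hence "q ^ 3 * H (- 1 - n) = - ((- 1) powi n * (q ^ 3 * q powi (12 * n * (n + 1)) * z) / (1 + z))"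
        by (simp add: mult_ac)
      also have "\<dots> = (- 1) powi n * (E m * q powi (m ^ 2) * e m)"
        unfolding 3 Ej z_def[symmetric] by (simp add: uminus_one_powi m_def)
      finally have h: "q ^ 3 * H (- 1 - n) = (- 1) powi n * (E m * q powi (m ^ 2) * e m)" .
      have i: "\<i> powi m = \<i> * (- 1) powi n" "(- \<i>) powi m = - \<i> * (- 1) powi n"
        unfolding m_def by (simp_all add: power_int_add ii_powi_even)
      have "R m = \<kappa> * ((- 1) powi n * (E m * q powi (m ^ 2) * e m))"
        unfolding R_def i by (simp add: field_simps)
      thus ?thesis unfolding h by (simp add: m_def)
    qed
    ultimately have R1: "((\<lambda>n. R (int 2 * n + int 1)) has_sum \<kappa> * (q ^ 3 * (euler_f 8 q * mock_omega (- (q ^ 4))))) UNIV"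
      by (simp add: euler_f_def flip: power_mult)

    define V where "V = (\<lambda>j::nat. if j = 0 then \<kappa> * (euler_f 8 q * (mock_f (q ^ 8) / 2))
      else \<kappa> * (q ^ 3 * (euler_f 8 q * mock_omega (- (q ^ 4)))))"
    have "(R has_sum (\<Sum>j<2. V j)) UNIV"
    proof (rule has_sum_int_residues)
      fix j :: nat assume "j < 2"
      hence "j = 0 \<or> j = 1" by auto
      thus "((\<lambda>k. R (int 2 * k + int j)) has_sum V j) UNIV"
        using R0 R1 by (auto simp: V_def)
    qed auto
    hence "S - S1 = (\<Sum>j<2. V j)"
      using RS has_sum_unique by blast
    also have "\<dots> = V 0 + V 1"
      by (simp add: numeral_2_eq_2)
    finally show ?thesis by (simp add: V_def)
  qed

  define F1 F2 F4 F8 where "F1 = euler_f 1 q" and "F2 = euler_f 2 q" and "F4 = euler_f 4 q" and "F8 = euler_f 8 q"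
  have F: "F1 \<noteq> 0" "F2 \<noteq> 0" "F4 \<noteq> 0" "F8 \<noteq> 0"
    unfolding F1_def F2_def F4_def F8_def using euler_f_nonzero[OF assms(1)] by auto
  have \<rho>_eq: "\<rho> = F4 ^ 2 / (F2 * F8)"
    using qpoch_inf_neg_odd[OF A.norm_q A.q_nz]
    by (simp add: \<rho>_def euler_f_power F2_def F4_def F8_def flip: power_mult)
  have th1: "theta q (q ^ 2) = (F1 / F2) ^ 2"
  proof -
    have "q ^ 2 / q = q" by (simp add: power2_eq_square)
    thus ?thesis by (simp add: theta_def F1_def F2_def power2_eq_square[of "_ / _"] qpoch_inf_odd[OF assms, unfolded One_nat_def])
  qed
  have th2: "theta (- 1) (q ^ 4) = 2 * (F8 / F4) ^ 2"
  proof -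
    have "qpoch_inf (- 1) (q ^ 4) = 2 * qpoch_inf (- (q ^ 4)) (q ^ 4)"
      using qpoch_inf_rec[OF B.norm_q, of "- 1"] by simp
    moreover have "qpoch_inf (- (q ^ 4)) (q ^ 4) = F8 / F4"
      using qpoch_inf_neg[OF B.norm_q B.q_nz] by (simp add: euler_f_power F4_def F8_def)
    ultimately show ?thesis by (simp add: theta_def power2_eq_square[of "_ / _"])
  qed
  have "S = S1 + (\<kappa> * (euler_f 8 q * (mock_f (q ^ 8) / 2)) + \<kappa> * (q ^ 3 * (euler_f 8 q * mock_omega (- (q ^ 4)))))"
    unfolding S2_eq[symmetric] by simp
  hence "F2 ^ 2 / (F1 / F2) ^ 2 * (F4 ^ 2 / (2 * (F8 / F4) ^ 2))
      = F4 ^ 2 / \<rho> ^ 2 * (q * (F2 * mock_omega q)) + F2 ^ 2 / \<rho> * F8 * (mock_f (q ^ 8) / 2 + q ^ 3 * mock_omega (- (q ^ 4)))"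
    unfolding S1_eq S_eq th1 th2 \<kappa>_def
    by (simp add: F1_def F2_def F4_def F8_def algebra_simps)
  \<comment> \<open>Inserting \<open>\<rho>_eq\<close> gives both parts on the right the common
    factor \<open>F2 ^ 3 * F8 ^ 2 / F4 ^ 2\<close>, which is finally cancelled.\<close>
  hence "F2 ^ 4 * F4 ^ 4 / (2 * F1 ^ 2 * F8 ^ 2)
      = F2 ^ 3 * F8 ^ 2 / F4 ^ 2 * (q * mock_omega q) + F2 ^ 3 * F8 ^ 2 / F4 ^ 2 * (mock_f (q ^ 8) / 2 + q ^ 3 * mock_omega (- (q ^ 4)))"
    unfolding \<rho>_eq using F by (simp add: field_simps power2_eq_square power4_eq_xxxx power3_eq_cube)
  also have "\<dots> = F2 ^ 3 * F8 ^ 2 / F4 ^ 2 * ((mock_f (q ^ 8) + 2 * q * mock_omega q + 2 * q ^ 3 * mock_omega (- (q ^ 4))) / 2)"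
    by (simp add: algebra_simps)
  also have "F2 ^ 4 * F4 ^ 4 / (2 * F1 ^ 2 * F8 ^ 2)
      = F2 ^ 3 * F8 ^ 2 / F4 ^ 2 * ((F2 * F4 ^ 6 / (F1 ^ 2 * F8 ^ 4)) / 2)"
    using F by (simp add: divide_simps) (simp add: algebra_simps eval_nat_numeral)
  finally have "(F2 * F4 ^ 6 / (F1 ^ 2 * F8 ^ 4)) / 2
      = (mock_f (q ^ 8) + 2 * q * mock_omega q + 2 * q ^ 3 * mock_omega (- (q ^ 4))) / 2"
    using F by (subst (asm) mult_cancel_left) auto
  thus ?thesis
    unfolding F1_def F2_def F4_def F8_def by (subst (asm) divide_cancel_right) simp
qed

section \<open>Dissections of theta functions\<close>

text \<open>Ramanujan's \<open>phi\<close>, and next \<open>psi\<close>, are introduced by their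
  product forms, so that the final quotients are field arithmetic in \<open>euler_f\<close>; their
  series are derived.\<close>

definition phi :: "complex \<Rightarrow> complex" where
  "phi q = euler_f 2 q ^ 5 / (euler_f 1 q ^ 2 * euler_f 4 q ^ 2)"

definition psi :: "complex \<Rightarrow> complex" where
  "psi q = euler_f 2 q ^ 2 / euler_f 1 q"

text \<open>The triple product at \<open>y = - 1 / q\<close>, where both products containing
  \<open>y\<close> become \<open>qpoch_inf (- q) (q ^ 2)\<close>.\<close>

lemma has_sum_phi:
  assumes "norm q < 1" "q \<noteq> 0"
  shows "((\<lambda>n. q powi (n * n)) has_sum phi q) UNIV"
proof -
  interpret nome q "q ^ 2" by unfold_locales (use assms in auto)
  have "tcoef q n * (- 1 / q) powi n = q powi (n * n)" for n
  proof -
    have "q powi (n * (n + 1)) = q powi (n * n) * q powi n"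
      using assms(2) by (subst power_int_add[symmetric]) (auto simp: algebra_simps)
    moreover have "(- 1 / q) powi n = (- 1) powi n / q powi n"
      by (rule power_int_divide_distrib)
    ultimately show ?thesis using assms(2) by (simp add: tcoef_def uminus_one_powi)
  qed
  moreover have "- 1 / q * q ^ 2 = - q" "1 / (- 1 / q) = - q"
    using assms(2) by (simp_all add: power2_eq_square)
  moreover have "- 1 / q \<noteq> 0" using assms(2) by simp
  ultimately have "((\<lambda>n. q powi (n * n)) has_sum
      qpoch_inf (- q) (q ^ 2) * qpoch_inf (- q) (q ^ 2) * qpoch_inf (q ^ 2) (q ^ 2)) UNIV"
    using jacobi_triple_product[of "- 1 / q"] by (simp only:) simp
  moreover have "qpoch_inf (- q) (q ^ 2) * qpoch_inf (- q) (q ^ 2) * qpoch_inf (q ^ 2) (q ^ 2) = phi q"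
    unfolding qpoch_inf_neg_odd[OF assms] euler_f_def[of 2, symmetric] phi_def
    by (simp add: power_mult_distrib power_divide eval_nat_numeral mult_ac)
  ultimately show ?thesis by (simp only:)
qed

text \<open>The triple product at \<open>y = - 1\<close>. The exponents at \<open>n\<close> and
  \<open>- 1 - n\<close> coincide, which accounts for the factor 2.\<close>

lemma has_sum_psi:
  assumes "norm q < 1" "q \<noteq> 0"
  shows "((\<lambda>n. q powi (n * (n + 1))) has_sum 2 * psi (q ^ 2)) UNIV"
proof -
  interpret nome q "q ^ 2" by unfold_locales (use assms in auto)
  have 1: "tcoef q n * (- 1) powi n = q powi (n * (n + 1))" for n
    by (simp add: tcoef_def uminus_one_powi)
  have 2: "qpoch_inf (1 / - 1) (q ^ 2) = 2 * qpoch_inf (- 1 * q ^ 2) (q ^ 2)"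
    using qpoch_inf_rec[OF norm_q, of "- 1"] by simp
  have 3: "qpoch_inf (- 1 * q ^ 2) (q ^ 2) = euler_f 4 q / euler_f 2 q"
    using qpoch_inf_neg[OF norm_q q_nz] by (simp add: euler_f_power)
  have "((\<lambda>n. q powi (n * (n + 1))) has_sum
      euler_f 4 q / euler_f 2 q * (2 * (euler_f 4 q / euler_f 2 q)) * euler_f 2 q) UNIV"
    using jacobi_triple_product[of "- 1"] unfolding 1 2 3 by (simp add: euler_f_def)
  moreover have "psi (q ^ 2) = euler_f 4 q ^ 2 / euler_f 2 q"
    by (simp add: psi_def euler_f_power)
  hence "euler_f 4 q / euler_f 2 q * (2 * (euler_f 4 q / euler_f 2 q)) * euler_f 2 q = 2 * psi (q ^ 2)"
    by (simp add: power2_eq_square[of "euler_f _ _"])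
  ultimately show ?thesis by (simp only:)
qed

text \<open>Even and odd \<open>n\<close> separate; an odd square is
  \<open>4 * k * (k + 1) + 1\<close>.\<close>

lemma phi_dissection:
  assumes "norm q < 1" "q \<noteq> 0"
  shows "phi q = phi (q ^ 4) + 2 * q * psi (q ^ 8)"
proof -
  define f where "f = (\<lambda>n. q powi (n * n))"
  have q4: "norm (q ^ 4) < 1" "q ^ 4 \<noteq> 0"
    using assms by (auto simp: norm_power power_less_one_iff)
  have "f (int 2 * k + int 0) = (q ^ 4) powi (k * k)" for k
    by (simp add: f_def power_int_power mult_ac)
  hence f0: "((\<lambda>k. f (int 2 * k + int 0)) has_sum phi (q ^ 4)) UNIV"
    using has_sum_phi[OF q4] by simp
  have "f (int 2 * k + int 1) = q * (q ^ 4) powi (k * (k + 1))" for k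
    unfolding f_def power_int_power using assms(2)
    by (subst power_int_add_1'[symmetric]) (auto simp: algebra_simps)
  hence f1: "((\<lambda>k. f (int 2 * k + int 1)) has_sum q * (2 * psi ((q ^ 4) ^ 2))) UNIV"
    using has_sum_cmult_right[OF has_sum_psi[OF q4], of q] by simp
  define V where "V = (\<lambda>j::nat. if j = 0 then phi (q ^ 4) else q * (2 * psi ((q ^ 4) ^ 2)))"
  have "(f has_sum (\<Sum>j<2. V j)) UNIV"
  proof (rule has_sum_int_residues)
    fix j :: nat assume "j < 2"
    hence "j = 0 \<or> j = 1" by auto
    thus "((\<lambda>k. f (int 2 * k + int j)) has_sum V j) UNIV"
      using f0 f1 by (auto simp: V_def)
  qed auto
  hence "phi q = (\<Sum>j<2. V j)"
    using has_sum_phi[OF assms] has_sum_unique unfolding f_def by blast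
  thus ?thesis
    by (simp add: V_def numeral_2_eq_2 flip: power_mult)
qed

lemma has_sum_times:
  fixes f :: "'a \<Rightarrow> complex" and g :: "'b \<Rightarrow> complex"
  assumes f: "(f has_sum F) A" and g: "(g has_sum G) B"
  shows "((\<lambda>(x, y). f x * g y) has_sum F * G) (A \<times> B)"
proof -
  have "(\<lambda>x. norm (f x)) summable_on A" "(\<lambda>x. norm (g x)) summable_on B"
    using f g by (auto simp: summable_on_iff_abs_summable_on_complex[symmetric] summable_on_def)
  from summable_on_times_norm[OF this]
  have "(\<lambda>p. norm ((\<lambda>(x, y). f x * g y) p)) summable_on A \<times> B"
    by (simp add: case_prod_unfold norm_mult)
  from abs_summable_summable[OF this]
  obtain S where S: "((\<lambda>(x, y). f x * g y) has_sum S) (A \<times> B)"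
    by (auto simp: summable_on_def)
  have "((\<lambda>x. f x * G) has_sum S) A"
    by (rule has_sum_SigmaD[OF S]) (use has_sum_cmult_right[OF g] in auto)
  moreover have "((\<lambda>x. f x * G) has_sum F * G) A"
    by (rule has_sum_cmult_left[OF f])
  ultimately show ?thesis using S has_sum_unique by blast
qed

text \<open>Rotation of the square lattice: pairs of even sum are \<open>(s + t, s - t)\<close> and
  double the form \<open>s * s + t * t\<close>; pairs of odd sum are
  \<open>(s + t + 1, s - t)\<close> and give the exponents of \<open>psi\<close>.\<close>

lemma phi_square:
  assumes "norm q < 1" "q \<noteq> 0"
  shows "phi q ^ 2 = phi (q ^ 2) ^ 2 + 4 * q * psi (q ^ 4) ^ 2"
proof -
  define f :: "int \<times> int \<Rightarrow> complex" where "f = (\<lambda>(m, n). q powi (m * m) * q powi (n * n))"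
  have f: "f (m, n) = q powi (m * m + n * n)" for m n
    using assms(2) by (simp add: f_def power_int_add)
  have q2: "norm (q ^ 2) < 1" "q ^ 2 \<noteq> 0"
    using assms by (auto simp: norm_power power_less_one_iff)
  have total: "(f has_sum phi q ^ 2) (UNIV \<times> UNIV)"
    using has_sum_times[OF has_sum_phi[OF assms] has_sum_phi[OF assms]]
    by (simp add: f_def power2_eq_square)
  have "f (s + t, s - t) = (q ^ 2) powi (s * s) * (q ^ 2) powi (t * t)" for s t
    unfolding f power_int_power using assms(2)
    by (subst power_int_add[symmetric]) (auto simp: algebra_simps)
  hence 1: "((\<lambda>p. f (fst p + snd p, fst p - snd p)) has_sum phi (q ^ 2) * phi (q ^ 2)) (UNIV \<times> UNIV)"
    using has_sum_times[OF has_sum_phi[OF q2] has_sum_phi[OF q2]] by (simp add: case_prod_unfold)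
  have "bij_betw (\<lambda>p. (fst p + snd p, fst p - snd p)) (UNIV \<times> UNIV) {(m, n :: int). even (m + n)}"
    by (rule bij_betwI[of _ _ _ "\<lambda>(m, n). ((m + n) div 2, (m - n) div 2)"]) (auto, presburger+)
  from has_sum_reindex_bij_betw[OF this, of f]
  have even: "(f has_sum phi (q ^ 2) * phi (q ^ 2)) {(m, n). even (m + n)}"
    using 1 by simp
  have "f (s + t + 1, s - t) = q * ((q ^ 2) powi (s * (s + 1)) * (q ^ 2) powi (t * (t + 1)))" for s t
    unfolding f power_int_power using assms(2)
    by (subst power_int_add[symmetric], simp, subst power_int_add_1'[symmetric]) (auto simp: algebra_simps)
  hence 2: "((\<lambda>p. f (fst p + snd p + 1, fst p - snd p)) has_sum
      q * ((2 * psi ((q ^ 2) ^ 2)) * (2 * psi ((q ^ 2) ^ 2)))) (UNIV \<times> UNIV)"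
    using has_sum_cmult_right[OF has_sum_times[OF has_sum_psi[OF q2] has_sum_psi[OF q2]], of q]
    by (simp add: case_prod_unfold)
  have "bij_betw (\<lambda>p. (fst p + snd p + 1, fst p - snd p)) (UNIV \<times> UNIV) {(m, n :: int). odd (m + n)}"
    by (rule bij_betwI[of _ _ _ "\<lambda>(m, n). ((m + n) div 2, (m - n) div 2)"])
       (auto, presburger+)
  from has_sum_reindex_bij_betw[OF this, of f]
  have odd: "(f has_sum q * ((2 * psi ((q ^ 2) ^ 2)) * (2 * psi ((q ^ 2) ^ 2)))) {(m, n). odd (m + n)}"
    using 2 by simp
  have "(f has_sum phi (q ^ 2) * phi (q ^ 2) + q * ((2 * psi ((q ^ 2) ^ 2)) * (2 * psi ((q ^ 2) ^ 2))))
      ({(m, n). even (m + n)} \<union> {(m, n). odd (m + n)})"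
    by (rule has_sum_Un_disjoint[OF even odd]) auto
  moreover have "{(m, n). even (m + n)} \<union> {(m, n :: int). odd (m + n)} = UNIV \<times> UNIV"
    by auto
  ultimately have "phi q ^ 2 = phi (q ^ 2) * phi (q ^ 2) + q * ((2 * psi ((q ^ 2) ^ 2)) * (2 * psi ((q ^ 2) ^ 2)))"
    using total has_sum_unique by metis
  thus ?thesis
    by (simp add: power2_eq_square[of "phi _"] power2_eq_square[of "psi _"] flip: power_mult)
qed

text \<open>After completing squares this is the invariance of \<open>a\<^sup>2 + 3b\<^sup>2\<close> under
  \<open>(a, b) \<mapsto> ((a + 3b)/2, (a - b)/2)\<close>, applied to the pairs of odd numbers for which the image is even;
  the reflection of \<open>b\<close> exchanges them with the remaining pairs of odd numbers.\<close>

lemma psi_psi: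
  assumes "norm q < 1" "q \<noteq> 0"
  shows "psi (q ^ 2) * psi (q ^ 6) = phi (q ^ 12) * psi (q ^ 8) + q ^ 2 * phi (q ^ 4) * psi (q ^ 24)"
proof -
  define f :: "int \<times> int \<Rightarrow> complex" where
    "f = (\<lambda>(m, n). q powi (m * (m + 1)) * (q ^ 3) powi (n * (n + 1)))"
  have f: "f (m, n) = q powi (m * (m + 1) + 3 * (n * (n + 1)))" for m n
    using assms(2) by (simp add: f_def power_int_add power_int_power)
  have qk: "norm (q ^ k) < 1" "q ^ k \<noteq> 0" if "k > 0" for k
    using assms that by (auto simp: norm_power power_less_one_iff)
  have total: "(f has_sum (2 * psi (q ^ 2)) * (2 * psi ((q ^ 3) ^ 2))) (UNIV \<times> UNIV)"
    unfolding f_def using has_sum_times[OF has_sum_psi[OF assms] has_sum_psi[OF qk, of 3]] by simp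
  define X where "X = 2 * psi ((q ^ 4) ^ 2) * phi (q ^ 12)"
  define Y where "Y = q ^ 2 * (phi (q ^ 4) * (2 * psi ((q ^ 12) ^ 2)))"
  \<comment> \<open>The two classes with \<open>m - n\<close> even; in the parametrisations below
    \<open>m - n\<close> equals \<open>4 * t\<close> and \<open>4 * t + 2\<close>.\<close>
  define A0 A2 where "A0 = {(m, n :: int). (m - n) mod 4 = 0}" and "A2 = {(m, n :: int). (m - n) mod 4 = 2}"
  have "f (s + 3 * t, s - t) = (q ^ 4) powi (s * (s + 1)) * (q ^ 12) powi (t * t)" for s t
    unfolding f power_int_power using assms(2)
    by (subst power_int_add[symmetric]) (auto simp: algebra_simps)
  hence 1: "((\<lambda>p. f (fst p + 3 * snd p, fst p - snd p)) has_sum X) (UNIV \<times> UNIV)"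
    using has_sum_times[OF has_sum_psi[OF qk, of 4] has_sum_phi[OF qk, of 12]]
    by (simp add: case_prod_unfold X_def)
  have "bij_betw (\<lambda>p. (fst p + 3 * snd p, fst p - snd p)) (UNIV \<times> UNIV) A0"
    unfolding A0_def
  proof (rule bij_betwI[of _ _ _ "\<lambda>(m, n). (n + (m - n) div 4, (m - n) div 4)"])
    fix p :: "int \<times> int"
    show "(\<lambda>p. (fst p + 3 * snd p, fst p - snd p)) ((\<lambda>(m, n). (n + (m - n) div 4, (m - n) div 4)) p) = p"
      if "p \<in> {(m, n). (m - n) mod 4 = 0}"
      using that by (cases p) (simp, presburger)
  qed (auto simp: algebra_simps)
  from has_sum_reindex_bij_betw[OF this, of f] have A0: "(f has_sum X) A0"
    using 1 by simp
  have "f (s + 3 * t + 1, s - t - 1) = q ^ 2 * ((q ^ 4) powi (s * s) * (q ^ 12) powi (t * (t + 1)))" for s t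
  proof -
    have "f (s + 3 * t + 1, s - t - 1) = q powi (int 2) * ((q ^ 4) powi (s * s) * (q ^ 12) powi (t * (t + 1)))"
      unfolding f power_int_power using assms(2)
      by (subst power_int_add[symmetric], simp, subst power_int_add[symmetric]) (auto simp: algebra_simps)
    thus ?thesis by (simp only: power_int_of_nat)
  qed
  hence 2: "((\<lambda>p. f (fst p + 3 * snd p + 1, fst p - snd p - 1)) has_sum Y) (UNIV \<times> UNIV)"
    using has_sum_cmult_right[OF has_sum_times[OF has_sum_phi[OF qk, of 4] has_sum_psi[OF qk, of 12]], of "q ^ 2"]
    by (simp add: case_prod_unfold Y_def)
  have "bij_betw (\<lambda>p. (fst p + 3 * snd p + 1, fst p - snd p - 1)) (UNIV \<times> UNIV) A2"
    unfolding A2_def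
  proof (rule bij_betwI[of _ _ _ "\<lambda>(m, n). (n + 1 + (m - n) div 4, (m - n) div 4)"])
    fix p :: "int \<times> int"
    show "(\<lambda>p. (fst p + 3 * snd p + 1, fst p - snd p - 1)) ((\<lambda>(m, n). (n + 1 + (m - n) div 4, (m - n) div 4)) p) = p"
      if "p \<in> {(m, n). (m - n) mod 4 = 2}"
      using that by (cases p) (simp, presburger)
    show "(\<lambda>(m, n). (n + 1 + (m - n) div 4, (m - n) div 4)) ((\<lambda>p. (fst p + 3 * snd p + 1, fst p - snd p - 1)) p) = p"
      by (cases p) (simp; presburger)
    show "(\<lambda>p :: int \<times> int. (fst p + 3 * snd p + 1, fst p - snd p - 1)) \<in> UNIV \<times> UNIV \<rightarrow> {(m, n). (m - n) mod 4 = 2}"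
      by (rule Pi_I) (simp add: case_prod_unfold; presburger)
  qed auto
  from has_sum_reindex_bij_betw[OF this, of f] have A2: "(f has_sum Y) A2"
    using 2 by simp
  have ev: "(f has_sum X + Y) (A0 \<union> A2)"
    by (rule has_sum_Un_disjoint[OF A0 A2]) (auto simp: A0_def A2_def)
  \<comment> \<open>Replacing \<open>n\<close> by \<open>- 1 - n\<close> fixes
    \<open>n * (n + 1)\<close> but changes the parity of \<open>m - n\<close>.\<close>
  have "bij_betw (\<lambda>p. (fst p, - 1 - snd p)) (A0 \<union> A2) (- (A0 \<union> A2))"
    by (rule bij_betwI[of _ _ _ "\<lambda>p. (fst p, - 1 - snd p)"]) (auto simp: A0_def A2_def, presburger+)
  from has_sum_reindex_bij_betw[OF this, of f]
  have "((\<lambda>p. f (fst p, - 1 - snd p)) has_sum X + Y) (A0 \<union> A2) = (f has_sum X + Y) (- (A0 \<union> A2))" .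
  moreover have "f (fst p, - 1 - snd p) = f p" for p
    by (cases p) (simp add: f algebra_simps)
  ultimately have "(f has_sum X + Y) (- (A0 \<union> A2))"
    using ev by simp
  hence "(f has_sum (X + Y) + (X + Y)) ((A0 \<union> A2) \<union> - (A0 \<union> A2))"
    by (rule has_sum_Un_disjoint[OF ev]) auto
  hence "(2 * psi (q ^ 2)) * (2 * psi ((q ^ 3) ^ 2)) = (X + Y) + (X + Y)"
    using total has_sum_unique by (metis Compl_partition UNIV_Times_UNIV)
  hence "4 * (psi (q ^ 2) * psi (q ^ 6)) = 4 * (phi (q ^ 12) * psi (q ^ 8) + q ^ 2 * phi (q ^ 4) * psi (q ^ 24))"
    by (simp add: X_def Y_def algebra_simps flip: power_mult)
  thus ?thesis
    by (simp only: mult_cancel_left) simp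
qed

section \<open>Dissection of xi\<close>

text \<open>Watson's relation at \<open>q ^ 3\<close> eliminates \<open>mock_omega (q ^ 3)\<close>.
  The common denominator \<open>euler_f 12 q ^ 2\<close> is a function of \<open>q ^ 4\<close>, so
  only the numerator remains to be dissected.\<close>

lemma mock_xi_theta:
  assumes "norm q < 1" "q \<noteq> 0"
  shows "2 * q * mock_xi q = (phi (q ^ 3) * phi (q ^ 6) ^ 2 + 2 * q * (phi q * (psi (q ^ 2) * psi (q ^ 6)))) / euler_f 12 q ^ 2
    - mock_f (q ^ 24) - 2 * q ^ 9 * mock_omega (- (q ^ 12))"
proof -
  have q3: "norm (q ^ 3) < 1" "q ^ 3 \<noteq> 0"
    using assms by (auto simp: norm_power power_less_one_iff)
  have nz: "euler_f k q \<noteq> 0" if "k > 0" for k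
    using euler_f_nonzero[OF assms(1) that] .
  have "mock_xi q - q ^ 2 * mock_omega (q ^ 3) = euler_f 2 q ^ 4 / euler_f 1 q ^ 2 / euler_f 6 q"
    using nz[of 6] unfolding mock_xi_eq_mock_omega[OF assms, symmetric] by simp
  also have "\<dots> = phi q * (psi (q ^ 2) * psi (q ^ 6)) / euler_f 12 q ^ 2"
    using nz[of 1] nz[of 2] nz[of 4] nz[of 6] nz[of 12]
    by (simp add: phi_def psi_def euler_f_power divide_simps) (simp add: eval_nat_numeral)
  finally have A: "mock_xi q - q ^ 2 * mock_omega (q ^ 3) = phi q * (psi (q ^ 2) * psi (q ^ 6)) / euler_f 12 q ^ 2" .
  have "mock_f (q ^ 24) + 2 * q ^ 3 * mock_omega (q ^ 3) + 2 * q ^ 9 * mock_omega (- (q ^ 12))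
      = euler_f 6 q * euler_f 12 q ^ 6 / (euler_f 3 q ^ 2 * euler_f 24 q ^ 4)"
    using watson_mock_theta[OF q3] by (simp add: euler_f_power flip: power_mult)
  also have "\<dots> = phi (q ^ 3) * phi (q ^ 6) ^ 2 / euler_f 12 q ^ 2"
    using nz[of 3] nz[of 6] nz[of 12] nz[of 24]
    by (simp add: phi_def euler_f_power divide_simps) (simp add: eval_nat_numeral)
  finally have B: "mock_f (q ^ 24) + 2 * q ^ 3 * mock_omega (q ^ 3) + 2 * q ^ 9 * mock_omega (- (q ^ 12))
      = phi (q ^ 3) * phi (q ^ 6) ^ 2 / euler_f 12 q ^ 2" .
  have "2 * q * mock_xi q = 2 * q * (mock_xi q - q ^ 2 * mock_omega (q ^ 3)) + 2 * q ^ 3 * mock_omega (q ^ 3)"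
    by (simp add: algebra_simps eval_nat_numeral)
  also have "2 * q ^ 3 * mock_omega (q ^ 3) = phi (q ^ 3) * phi (q ^ 6) ^ 2 / euler_f 12 q ^ 2
      - mock_f (q ^ 24) - 2 * q ^ 9 * mock_omega (- (q ^ 12))"
    unfolding B[symmetric] by simp
  finally show ?thesis
    unfolding A by (simp add: add_divide_distrib)
qed

text \<open>The parts \<open>0, 1, 2\<close> are the generating functions of \<open>p_xi (4 * n + k)\<close>; the last one is that of
  \<open>2 * p_xi (4 * n + 3)\<close> multiplied by \<open>Q\<close>.\<close>

definition xi_part :: "nat \<Rightarrow> complex \<Rightarrow> complex" where
  "xi_part k Q = (if k = 0 then 4 * Q ^ 2 * psi (Q ^ 6) ^ 3 / euler_f 3 Q ^ 2 - Q ^ 2 * mock_omega (- (Q ^ 3))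
      + phi (Q ^ 3) * phi Q * psi (Q ^ 2) / euler_f 3 Q ^ 2
    else if k = 1 then 2 * Q * phi (Q ^ 3) * psi (Q ^ 6) ^ 2 / euler_f 3 Q ^ 2
      + 2 * phi (Q ^ 3) * psi (Q ^ 2) ^ 2 / euler_f 3 Q ^ 2
    else if k = 2 then phi (Q ^ 3) ^ 2 * psi (Q ^ 6) / euler_f 3 Q ^ 2
      + phi Q ^ 2 * psi (Q ^ 6) / euler_f 3 Q ^ 2
    else phi (Q ^ 3) ^ 3 / euler_f 3 Q ^ 2 - mock_f (Q ^ 6)
      + 4 * Q * phi Q * psi (Q ^ 2) * psi (Q ^ 6) / euler_f 3 Q ^ 2)"

text \<open>The quantities \<open>a\<close>, \<open>b\<close>, \<open>A\<close>, \<open>B\<close>,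
  \<open>D\<close> depend on \<open>q ^ 4\<close> alone. After substitution the numerator is a
  polynomial in \<open>q\<close> over them, and its powers are sorted modulo 4.\<close>

lemma mock_xi_dissection:
  assumes "norm q < 1" "q \<noteq> 0"
  shows "2 * q * mock_xi q = xi_part 3 (q ^ 4)
    + 2 * q * (xi_part 0 (q ^ 4) + q * xi_part 1 (q ^ 4) + q ^ 2 * xi_part 2 (q ^ 4))"
proof -
  have q3: "norm (q ^ 3) < 1" "q ^ 3 \<noteq> 0" and q6: "norm (q ^ 6) < 1" "q ^ 6 \<noteq> 0"
    using assms by (auto simp: norm_power power_less_one_iff)
  define a b A B D where "a = phi (q ^ 4)" and "b = psi (q ^ 8)" and "A = phi (q ^ 12)"
    and "B = psi (q ^ 24)" and "D = euler_f 12 q ^ 2"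
  have 1: "phi (q ^ 3) = A + 2 * q ^ 3 * B"
    using phi_dissection[OF q3] by (simp add: A_def B_def flip: power_mult)
  have 2: "phi (q ^ 6) ^ 2 = A ^ 2 + 4 * q ^ 6 * B ^ 2"
    using phi_square[OF q6] by (simp add: A_def B_def flip: power_mult)
  have 3: "phi q = a + 2 * q * b"
    using phi_dissection[OF assms] by (simp add: a_def b_def)
  have 4: "psi (q ^ 2) * psi (q ^ 6) = A * b + q ^ 2 * a * B"
    using psi_psi[OF assms] by (simp add: a_def b_def A_def B_def)
  have r: "xi_part 0 (q ^ 4) = 4 * q ^ 8 * B ^ 3 / D - q ^ 8 * mock_omega (- (q ^ 12)) + A * a * b / D"
    "xi_part 1 (q ^ 4) = 2 * q ^ 4 * A * B ^ 2 / D + 2 * A * b ^ 2 / D"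
    "xi_part 2 (q ^ 4) = A ^ 2 * B / D + a ^ 2 * B / D"
    "xi_part 3 (q ^ 4) = A ^ 3 / D - mock_f (q ^ 24) + 4 * q ^ 4 * a * b * B / D"
    by (simp_all add: xi_part_def a_def b_def A_def B_def D_def euler_f_power flip: power_mult)
  have "(A + 2 * q ^ 3 * B) * (A ^ 2 + 4 * q ^ 6 * B ^ 2) + 2 * q * ((a + 2 * q * b) * (A * b + q ^ 2 * a * B))
     = A ^ 3 + 4 * q ^ 4 * a * b * B + 2 * q * (4 * q ^ 8 * B ^ 3 + A * a * b
       + q * (2 * q ^ 4 * A * B ^ 2 + 2 * A * b ^ 2) + q ^ 2 * (A ^ 2 * B + a ^ 2 * B))"
    by algebra
  hence "2 * q * mock_xi q = (A ^ 3 + 4 * q ^ 4 * a * b * B + 2 * q * (4 * q ^ 8 * B ^ 3 + A * a * b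
       + q * (2 * q ^ 4 * A * B ^ 2 + 2 * A * b ^ 2) + q ^ 2 * (A ^ 2 * B + a ^ 2 * B))) / D
       - mock_f (q ^ 24) - 2 * q ^ 9 * mock_omega (- (q ^ 12))"
    unfolding mock_xi_theta[OF assms] 1 2 3 4 D_def[symmetric] by simp
  also have "2 * q ^ 9 * mock_omega (- (q ^ 12)) = 2 * q * (q ^ 8 * mock_omega (- (q ^ 12)))"
    by (simp add: eval_nat_numeral)
  finally show ?thesis
    unfolding r by (simp add: add_divide_distrib diff_divide_distrib algebra_simps)
qed

section \<open>Extraction of the residue classes modulo 4\<close>

lemma sums_mod_4:
  fixes p :: "nat \<Rightarrow> complex"
  assumes s: "\<And>u. u ^ 4 = 1 \<Longrightarrow> (\<lambda>n. p n * (u * q) ^ n) sums F (u * q)" and r: "r < 4"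
  shows "(\<lambda>k. p (4 * k + r) * q ^ (4 * k + r)) sums
    ((F q + (- \<i>) ^ r * F (\<i> * q) + (- 1) ^ r * F (- q) + \<i> ^ r * F (- \<i> * q)) / 4)"
proof -
  define g where "g = (\<lambda>n. if n mod 4 = r then p n * q ^ n else 0)"
  have "(\<lambda>n. (p n * (1 * q) ^ n + (- \<i>) ^ r * (p n * (\<i> * q) ^ n) + (- 1) ^ r * (p n * (- 1 * q) ^ n)
      + \<i> ^ r * (p n * (- \<i> * q) ^ n)) / 4) sums
    ((F (1 * q) + (- \<i>) ^ r * F (\<i> * q) + (- 1) ^ r * F (- 1 * q) + \<i> ^ r * F (- \<i> * q)) / 4)"
    by (intro sums_divide sums_add sums_mult s) (auto simp: eval_nat_numeral)
  moreover have "(p n * (1 * q) ^ n + (- \<i>) ^ r * (p n * (\<i> * q) ^ n) + (- 1) ^ r * (p n * (- 1 * q) ^ n)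
      + \<i> ^ r * (p n * (- \<i> * q) ^ n)) / 4 = g n" for n
  proof -
    define m s where "m = n div 4" and "s = n mod 4"
    have n: "n = 4 * m + s" and s4: "s < 4" by (auto simp: m_def s_def)
    have pw: "u ^ n = u ^ s" if "u ^ 4 = 1" for u :: complex
      unfolding n by (simp add: power_add power_mult that)
    have u: "\<i> ^ n = \<i> ^ s" "(- \<i>) ^ n = (- \<i>) ^ s" "(- 1 :: complex) ^ n = (- 1) ^ s"
      by (rule pw, simp add: eval_nat_numeral)+
    \<comment> \<open>Orthogonality of the fourth roots of unity, checked for all pairs of
      residues.\<close>
    have "1 + (- \<i>) ^ r * \<i> ^ s + (- 1) ^ r * (- 1) ^ s + \<i> ^ r * (- \<i>) ^ s = (if s = r then 4 else 0)"
    proof -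
      have "r = 0 \<or> r = 1 \<or> r = 2 \<or> r = 3" "s = 0 \<or> s = 1 \<or> s = 2 \<or> s = 3"
        using r s4 by auto
      thus ?thesis by (elim disjE) (simp_all add: eval_nat_numeral)
    qed
    hence "p n * q ^ n * (1 + (- \<i>) ^ r * \<i> ^ n + (- 1) ^ r * (- 1) ^ n + \<i> ^ r * (- \<i>) ^ n) / 4 = g n"
      unfolding u by (simp add: g_def s_def)
    thus ?thesis unfolding power_mult_distrib by (simp add: algebra_simps)
  qed
  ultimately have "g sums ((F q + (- \<i>) ^ r * F (\<i> * q) + (- 1) ^ r * F (- q) + \<i> ^ r * F (- \<i> * q)) / 4)"
    by simp
  moreover have "strict_mono (\<lambda>k. 4 * k + r)" by (auto simp: strict_mono_def)
  moreover have "g n = 0" if "n \<notin> range (\<lambda>k. 4 * k + r)" for n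
  proof -
    have "n mod 4 \<noteq> r" using that by (metis mult_div_mod_eq rangeI)
    thus ?thesis by (simp add: g_def)
  qed
  ultimately have "(\<lambda>k. g (4 * k + r)) sums
      ((F q + (- \<i>) ^ r * F (\<i> * q) + (- 1) ^ r * F (- q) + \<i> ^ r * F (- \<i> * q)) / 4)"
    by (subst sums_mono_reindex) auto
  thus ?thesis using r by (simp add: g_def)
qed

lemma complex_4th_root: "\<exists>q :: complex. q ^ 4 = Q"
proof
  show "csqrt (csqrt Q) ^ 4 = Q"
    using power_mult[of "csqrt (csqrt Q)" 2 2] by simp
qed

text \<open>Let \<open>q\<close> be a fourth root of \<open>Q\<close>. The parts take the same value
  at all \<open>u * q\<close> with \<open>u ^ 4 = 1\<close>, so averaging \<open>mock_xi\<close>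
  over these points with suitable weights isolates one part, while the coefficients select one
  class.\<close>

lemma p_xi_dissection:
  assumes "norm Q < 1" "Q \<noteq> 0"
  shows "(\<lambda>n. p_xi (4 * n) * Q ^ n) sums xi_part 0 Q"
    and "(\<lambda>n. p_xi (4 * n + 1) * Q ^ n) sums xi_part 1 Q"
    and "(\<lambda>n. p_xi (4 * n + 2) * Q ^ n) sums xi_part 2 Q"
    and "(\<lambda>n. 2 * (p_xi (4 * n + 3) * Q ^ (n + 1))) sums xi_part 3 Q"
proof -
  obtain q where q: "q ^ 4 = Q" using complex_4th_root by blast
  have q0: "q \<noteq> 0" using q assms(2) by auto
  have "norm q ^ 4 < 1" using assms(1) q by (metis norm_power)
  hence q1: "norm q < 1" by (subst (asm) power_less_one_iff) auto
  have u1: "norm u = 1" if "u ^ 4 = 1" for u :: complex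
    using that by (metis norm_one norm_power norm_ge_zero power_eq_1_iff zero_neq_numeral)
  have s: "(\<lambda>n. p_xi n * (u * q) ^ n) sums mock_xi (u * q)" if "u ^ 4 = 1" for u
    using p_xi_sums[of "u * q"] u1[OF that] q1 by (simp add: norm_mult)
  define X0 X1 X2 X3 where X: "X0 = xi_part 0 Q" "X1 = xi_part 1 Q" "X2 = xi_part 2 Q" "X3 = xi_part 3 Q"
  have xi: "mock_xi (u * q) = u ^ 3 * (X3 / (2 * q)) + X0 + u * (q * X1) + u ^ 2 * (q ^ 2 * X2)"
    if "u ^ 4 = 1" for u
  proof -
    have u: "u * q \<noteq> 0" "norm (u * q) < 1" "(u * q) ^ 4 = Q"
      using u1[OF that] q0 q1 that q by (auto simp: norm_mult power_mult_distrib)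
    have "u ^ 3 * u = 1" using that by (simp add: eval_nat_numeral mult_ac)
    hence u3: "u ^ 3 = 1 / u" using u(1) by (simp add: field_simps)
    have "2 * (u * q) * mock_xi (u * q) = X3 + 2 * (u * q) * (X0 + u * q * X1 + (u * q) ^ 2 * X2)"
      using mock_xi_dissection[OF u(2,1)] unfolding u(3) X .
    thus ?thesis
      unfolding u3 using u(1) by (simp add: field_simps power2_eq_square)
  qed
  have i4: "\<i> ^ 4 = 1" "(- \<i>) ^ 4 = 1" by (simp_all add: eval_nat_numeral)
  have x: "mock_xi q = X3 / (2 * q) + X0 + q * X1 + q ^ 2 * X2"
    "mock_xi (\<i> * q) = - \<i> * (X3 / (2 * q)) + X0 + \<i> * (q * X1) - q ^ 2 * X2"
    "mock_xi (- q) = - (X3 / (2 * q)) + X0 - q * X1 + q ^ 2 * X2"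
    "mock_xi (- \<i> * q) = \<i> * (X3 / (2 * q)) + X0 - \<i> * (q * X1) - q ^ 2 * X2"
    using xi[of 1] xi[OF i4(1)] xi[of "- 1"] xi[OF i4(2)]
    by (simp_all add: power3_eq_cube)
  have e: "q ^ (4 * k + r) = q ^ r * Q ^ k" for k r
    by (simp add: power_add power_mult q)
  have main: "(\<lambda>k. p_xi (4 * k + r) * Q ^ k) sums (1 / q ^ r *
      ((mock_xi q + (- \<i>) ^ r * mock_xi (\<i> * q) + (- 1) ^ r * mock_xi (- q) + \<i> ^ r * mock_xi (- \<i> * q)) / 4))"
    if "r < 4" for r
    using sums_mult[OF sums_mod_4[of p_xi q mock_xi, OF s that], of "1 / q ^ r"] q0
    unfolding e by (simp add: mult_ac)
  show "(\<lambda>n. p_xi (4 * n) * Q ^ n) sums xi_part 0 Q"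
    using main[of 0] unfolding x X[symmetric] by simp
  show "(\<lambda>n. p_xi (4 * n + 1) * Q ^ n) sums xi_part 1 Q"
  proof -
    have "1 / q ^ 1 * ((mock_xi q + (- \<i>) ^ 1 * mock_xi (\<i> * q) + (- 1) ^ 1 * mock_xi (- q) + \<i> ^ 1 * mock_xi (- \<i> * q)) / 4)
        = xi_part 1 Q"
      unfolding x X[symmetric] using q0 by (simp add: field_simps)
    thus ?thesis using main[of 1] by (simp only:)
  qed
  show "(\<lambda>n. p_xi (4 * n + 2) * Q ^ n) sums xi_part 2 Q"
  proof -
    have "1 / q ^ 2 * ((mock_xi q + (- \<i>) ^ 2 * mock_xi (\<i> * q) + (- 1) ^ 2 * mock_xi (- q) + \<i> ^ 2 * mock_xi (- \<i> * q)) / 4)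
        = xi_part 2 Q"
      unfolding x X[symmetric] using q0 by (simp add: field_simps)
    thus ?thesis using main[of 2] by (simp only:)
  qed
  show "(\<lambda>n. 2 * (p_xi (4 * n + 3) * Q ^ (n + 1))) sums xi_part 3 Q"
  proof -
    \<comment> \<open>The average is \<open>X3 / (2 * q)\<close>; dividing it by
      \<open>q ^ 3\<close> and multiplying by \<open>2 * Q = 2 * q ^ 4\<close> leaves
      \<open>X3\<close>.\<close>
    have "2 * Q * (1 / q ^ 3 * ((mock_xi q + (- \<i>) ^ 3 * mock_xi (\<i> * q) + (- 1) ^ 3 * mock_xi (- q) + \<i> ^ 3 * mock_xi (- \<i> * q)) / 4))
        = xi_part 3 Q"
      unfolding x X[symmetric] unfolding q[symmetric] using q0 by (simp add: field_simps eval_nat_numeral)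
    thus ?thesis using sums_mult[OF main[of 3], of "2 * Q"] by (simp only:) (simp add: mult_ac)
  qed
qed

section \<open>The first coefficients of xi\<close>

lemma mock_xi_remainder:
  obtains S where "\<And>q. norm q \<le> 1 / 4 \<Longrightarrow> mock_xi q = 1 + 2 * (q / ((1 - q) * (1 - q ^ 5)) + S q)"
    and "\<And>q. norm q \<le> 1 / 4 \<Longrightarrow> norm (S q) \<le> norm q ^ 3"
proof -
  have 1: "norm (xi_term (Suc (Suc n)) q) \<le> norm q ^ 3 / 2 * (1 / 2) ^ n" if q: "norm q \<le> 1 / 4" for q n
  proof -
    define r where "r = norm q"
    have r: "0 \<le> r" "r \<le> 1 / 4" using q by (auto simp: r_def)
    have "(3 / 4) ^ 2 \<le> (1 - r) ^ 2" using r by (intro power_mono) auto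
    hence "1 / 2 \<le> (1 - r) ^ 2" by (simp add: power2_eq_square)
    moreover have "r ^ (6 * Suc n) \<le> r ^ 6" using r by (intro power_decreasing) auto
    ultimately have "r ^ (6 * Suc n) / (1 - r) ^ 2 \<le> r ^ 6 / (1 / 2)"
      using r by (intro frac_le) auto
    hence "(r ^ (6 * Suc n) / (1 - r) ^ 2) ^ Suc (Suc n) \<le> (r ^ 6 * 2) ^ Suc (Suc n)"
      using r by (intro power_mono) auto
    also have "\<dots> = (r ^ 6 * 2) ^ n * (r ^ 3 * (4 * r ^ 9))"
      by (simp add: eval_nat_numeral)
    also have "\<dots> \<le> (1 / 2) ^ n * (r ^ 3 * (1 / 2))"
    proof (intro mult_mono power_mono)
      have "r ^ 6 \<le> (1 / 4) ^ 6" "r ^ 9 \<le> (1 / 4) ^ 9" using r by (intro power_mono; simp)+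
      thus "r ^ 6 * 2 \<le> 1 / 2" "4 * r ^ 9 \<le> 1 / 2" by (simp_all add: eval_nat_numeral)
    qed (use r in auto)
    finally show ?thesis
      using norm_xi_term_le[of q r "Suc n"] r by (simp add: r_def mult_ac)
  qed
  \<comment> \<open>The series from index 2 on. Order 3 at the origin suffices to read off the
    coefficients up to \<open>q ^ 2\<close>.\<close>
  define S where "S = (\<lambda>q. \<Sum>n. xi_term (Suc (Suc n)) q)"
  have sm: "summable (\<lambda>n. xi_term (Suc (Suc n)) q)" if "norm q \<le> 1 / 4" for q
    using 1[OF that] by (rule summable_comparison_test'[where N = 0, rotated]) (intro summable_mult summable_geometric, simp)
  show ?thesis
  proof (rule that[of S])
    fix q :: complex assume q: "norm q \<le> 1 / 4"
    have "(\<Sum>n. xi_term (Suc n) q) = xi_term (Suc 0) q + S q"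
      using suminf_split_head[of "\<lambda>n. xi_term (Suc n) q"] sm[OF q] summable_Suc_iff[of "\<lambda>n. xi_term (Suc n) q"]
      by (simp add: S_def)
    thus "mock_xi q = 1 + 2 * (q / ((1 - q) * (1 - q ^ 5)) + S q)"
      by (simp add: mock_xi_def xi_term_def qpoch_Suc)
    have "norm (S q) \<le> (\<Sum>n. norm q ^ 3 / 2 * (1 / 2) ^ n)"
      unfolding S_def by (rule norm_suminf_le[OF 1[OF q]]) (intro summable_mult summable_geometric, simp)
    also have "\<dots> = norm q ^ 3 / 2 * 2"
      by (subst suminf_mult) (auto simp: suminf_geometric intro!: summable_geometric)
    finally show "norm (S q) \<le> norm q ^ 3" by simp
  qed
qed

text \<open>\<open>p_xi_dissection\<close> assumes \<open>Q \<noteq> 0\<close>, so the constant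
  terms at \<open>q = 0\<close> are found directly: take the limit at 0, subtract it, divide by
  \<open>q\<close>, and repeat.\<close>

lemma p_xi_0_1_2: "p_xi 0 = 1" "p_xi 1 = 2" "p_xi 2 = 2"
proof -
  obtain S where S: "\<And>q. norm q \<le> 1 / 4 \<Longrightarrow> mock_xi q = 1 + 2 * (q / ((1 - q) * (1 - q ^ 5)) + S q)"
    "\<And>q. norm q \<le> 1 / 4 \<Longrightarrow> norm (S q) \<le> norm q ^ 3"
    using mock_xi_remainder by blast
  have near: "eventually (\<lambda>q::complex. q \<noteq> 0 \<and> norm q < 1 / 4) (at 0)"
    unfolding eventually_at by (intro exI[of _ "1 / 4"]) auto
  have T: "((\<lambda>q. S q / q ^ 2) \<longlongrightarrow> 0) (at 0)"
  proof (rule Lim_null_comparison)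
    show "eventually (\<lambda>q. norm (S q / q ^ 2) \<le> norm q) (at 0)"
      using near
    proof eventually_elim
      case (elim q)
      thus ?case using S(2)[of q]
        by (simp add: norm_divide norm_power norm_mult pos_divide_le_eq eval_nat_numeral)
    qed
    show "((\<lambda>q. norm q) \<longlongrightarrow> 0) (at (0::complex))" by (intro tendsto_eq_intros) auto
  qed
  have p: "(\<lambda>n. p_xi n * q ^ n) sums mock_xi q" if "norm q < 1 / 4" for q
    using p_xi_sums[of q] that by simp
  define K where "K = (\<lambda>q. 2 * (1 / ((1 - q) * (1 - q ^ 5)) + q * (S q / q ^ 2)))"
  have K: "(K \<longlongrightarrow> 2) (at 0)"
    unfolding K_def by (rule tendsto_eq_intros T refl | simp)+
  have xi: "mock_xi q = 1 + q * K q" if "q \<noteq> 0" "norm q < 1 / 4" for q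
    using S(1)[of q] that by (simp add: K_def power2_eq_square algebra_simps)
  have "((\<lambda>q. 1 + q * K q) \<longlongrightarrow> 1) (at 0)"
    by (rule tendsto_eq_intros K refl | simp)+
  moreover have "eventually (\<lambda>q. 1 + q * K q = mock_xi q) (at 0)"
    using near by eventually_elim (use xi in auto)
  ultimately have "(mock_xi \<longlongrightarrow> 1) (at 0)"
    by (rule Lim_transform_eventually)
  moreover have "(mock_xi \<longlongrightarrow> p_xi 0) (at 0)"
    by (rule powser_limit_0[of "1 / 4"]) (use p in auto)
  ultimately show p0: "p_xi 0 = 1"
    using tendsto_unique[OF trivial_limit_at] by blast
  have p': "(\<lambda>n. p_xi (Suc n) * q ^ n) sums K q" if "q \<noteq> 0" "norm q < 1 / 4" for q
  proof -
    have "(\<lambda>n. p_xi (Suc n) * q ^ Suc n) sums (q * K q)"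
      using sums_Suc_iff[of "\<lambda>n. p_xi n * q ^ n" "q * K q"] p[OF that(2)] xi[OF that] p0 by (simp add: add.commute)
    from sums_mult[OF this, of "1 / q"] show ?thesis using that(1) by simp
  qed
  have "(K \<longlongrightarrow> p_xi (Suc 0)) (at 0)"
    by (rule powser_limit_0_strong[of "1 / 4"]) (use p' in auto)
  hence p1: "p_xi (Suc 0) = 2"
    using K tendsto_unique[OF trivial_limit_at] by blast
  thus "p_xi 1 = 2" by simp
  \<comment> \<open>The next quotient, with \<open>K q = 2 + q * L q\<close>; its numerator comes
    from \<open>1 - (1 - q) * (1 - q ^ 5) = q * (1 + q ^ 4 - q ^ 5)\<close>.\<close>
  define L where "L = (\<lambda>q. 2 * ((1 + q ^ 4 - q ^ 5) / ((1 - q) * (1 - q ^ 5)) + S q / q ^ 2))"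
  have L: "(L \<longlongrightarrow> 2) (at 0)"
    unfolding L_def by (rule tendsto_eq_intros T refl | simp)+
  have KL: "K q = 2 + q * L q" if "q \<noteq> 0" "norm q < 1 / 4" for q
  proof -
    have "norm (q ^ 5) < 1"
      unfolding norm_power using that by (subst power_less_one_iff) auto
    hence "1 - q \<noteq> 0" "1 - q ^ 5 \<noteq> 0" using that by auto
    hence h: "1 / ((1 - q) * (1 - q ^ 5)) = 1 + q * ((1 + q ^ 4 - q ^ 5) / ((1 - q) * (1 - q ^ 5)))"
      by (simp add: divide_simps) (simp add: algebra_simps eval_nat_numeral)
    show ?thesis unfolding K_def L_def h by (simp only: ring_distribs mult_ac mult_1_left mult_1_right add_ac)
  qed
  have "(\<lambda>n. p_xi (Suc (Suc n)) * q ^ n) sums L q" if "q \<noteq> 0" "norm q < 1 / 4" for q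
  proof -
    have "(\<lambda>n. p_xi (Suc (Suc n)) * q ^ Suc n) sums (q * L q)"
      using sums_Suc_iff[of "\<lambda>n. p_xi (Suc n) * q ^ n" "q * L q"] p'[OF that] KL[OF that] p1 by (simp add: add.commute)
    from sums_mult[OF this, of "1 / q"] show ?thesis using that(1) by simp
  qed
  hence "(L \<longlongrightarrow> p_xi (Suc (Suc 0))) (at 0)"
    by (intro powser_limit_0_strong[of "1 / 4"]) auto
  hence "p_xi (Suc (Suc 0)) = 2"
    using L tendsto_unique[OF trivial_limit_at] by blast
  thus "p_xi 2 = 2" by (simp add: numeral_2_eq_2)
qed

lemma euler_f_0: "k > 0 \<Longrightarrow> euler_f k 0 = 1"
  unfolding euler_f_def by (rule qpoch_inf_unique) (simp add: qpoch_def[abs_def] zero_power)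

lemma mock_f_0: "mock_f 0 = 1"
proof -
  have "mock_f 0 = (\<Sum>n\<in>{0}. 0 ^ (n ^ 2) / qpoch (- 0) 0 n ^ 2)"
    unfolding mock_f_def by (rule suminf_finite) auto
  thus ?thesis by simp
qed

theorem theorem3p3:
  fixes q :: complex
  assumes "norm q < 1"
  shows
    "(\<lambda>n. p_xi (4 * n) * q ^ n) sums
       (4 * q ^ 2 * (euler_f 12 q ^ 6 / (euler_f 3 q ^ 2 * euler_f 6 q ^ 3))
        - q ^ 2 * mock_omega (- (q ^ 3))
        + euler_f 2 q ^ 4 * euler_f 6 q ^ 5
            / (euler_f 1 q ^ 2 * euler_f 3 q ^ 4 * euler_f 12 q ^ 2)) \<and>
     (\<lambda>n. p_xi (4 * n + 1) * q ^ n) sums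
       (2 * q * (euler_f 6 q ^ 3 * euler_f 12 q ^ 2 / euler_f 3 q ^ 4)
        + 2 * (euler_f 4 q ^ 4 * euler_f 6 q ^ 5
            / (euler_f 2 q ^ 2 * euler_f 3 q ^ 4 * euler_f 12 q ^ 2))) \<and>
     (\<lambda>n. p_xi (4 * n + 2) * q ^ n) sums
       (euler_f 6 q ^ 9 / (euler_f 3 q ^ 6 * euler_f 12 q ^ 2)
        + euler_f 2 q ^ 10 * euler_f 12 q ^ 2
            / (euler_f 1 q ^ 4 * euler_f 3 q ^ 2 * euler_f 4 q ^ 4 * euler_f 6 q)) \<and>
     (\<lambda>n. 2 * (p_xi (4 * n + 3) * q ^ (n + 1))) sums
       (euler_f 6 q ^ 15 / (euler_f 3 q ^ 8 * euler_f 12 q ^ 6)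
        - mock_f (q ^ 6)
        + 4 * q * (euler_f 2 q ^ 4 * euler_f 12 q ^ 2
            / (euler_f 1 q ^ 2 * euler_f 3 q ^ 2 * euler_f 6 q)))"
proof (cases "q = 0")
  case True
  \<comment> \<open>Since \<open>0 ^ 0 = 1\<close>, only \<open>n = 0\<close> contributes. In the
    last series the exponent \<open>n + 1\<close> removes even that term, in agreement with
    \<open>1 - mock_f 0 = 0\<close>.\<close>
  have "(\<lambda>n. p_xi (4 * n + r) * 0 ^ n) sums p_xi r" for r
    using powser_sums_zero[of "\<lambda>n. p_xi (4 * n + r)"] by simp
  from this[of 0] this[of 1] this[of 2] show ?thesis
    by (simp add: True euler_f_0 mock_f_0 p_xi_0_1_2 p_xi_0_1_2(2)[unfolded One_nat_def])
next
  case False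
  note nz = euler_f_nonzero[OF assms]
  \<comment> \<open>Each part becomes the stated quotient once \<open>phi\<close> and
    \<open>psi\<close> are replaced by their products.\<close>
  have "xi_part 0 q = 4 * q ^ 2 * (euler_f 12 q ^ 6 / (euler_f 3 q ^ 2 * euler_f 6 q ^ 3))
        - q ^ 2 * mock_omega (- (q ^ 3))
        + euler_f 2 q ^ 4 * euler_f 6 q ^ 5
            / (euler_f 1 q ^ 2 * euler_f 3 q ^ 4 * euler_f 12 q ^ 2)"
    using nz[of 1] nz[of 2] nz[of 3] nz[of 4] nz[of 6] nz[of 12]
    by (simp add: xi_part_def phi_def psi_def euler_f_power field_simps) (simp add: eval_nat_numeral)
  moreover have "xi_part 1 q = 2 * q * (euler_f 6 q ^ 3 * euler_f 12 q ^ 2 / euler_f 3 q ^ 4)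
        + 2 * (euler_f 4 q ^ 4 * euler_f 6 q ^ 5
            / (euler_f 2 q ^ 2 * euler_f 3 q ^ 4 * euler_f 12 q ^ 2))"
    using nz[of 1] nz[of 2] nz[of 3] nz[of 4] nz[of 6] nz[of 12]
    by (simp add: xi_part_def phi_def psi_def euler_f_power field_simps) (simp add: eval_nat_numeral)
  moreover have "xi_part 2 q = euler_f 6 q ^ 9 / (euler_f 3 q ^ 6 * euler_f 12 q ^ 2)
        + euler_f 2 q ^ 10 * euler_f 12 q ^ 2
            / (euler_f 1 q ^ 4 * euler_f 3 q ^ 2 * euler_f 4 q ^ 4 * euler_f 6 q)"
    using nz[of 1] nz[of 2] nz[of 3] nz[of 4] nz[of 6] nz[of 12]
    by (simp add: xi_part_def phi_def psi_def euler_f_power field_simps) (simp add: eval_nat_numeral)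
  moreover have "xi_part 3 q = euler_f 6 q ^ 15 / (euler_f 3 q ^ 8 * euler_f 12 q ^ 6)
        - mock_f (q ^ 6)
        + 4 * q * (euler_f 2 q ^ 4 * euler_f 12 q ^ 2
            / (euler_f 1 q ^ 2 * euler_f 3 q ^ 2 * euler_f 6 q))"
    using nz[of 1] nz[of 2] nz[of 3] nz[of 4] nz[of 6] nz[of 12]
    by (simp add: xi_part_def phi_def psi_def euler_f_power field_simps) (simp add: eval_nat_numeral)
  ultimately show ?thesis
    using p_xi_dissection[OF assms False] by (simp only:)
qed

end
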